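(* Let $\Gamma$ be a GKM-hypergraph and let $\mathcal{F}$ be a sheaf over $\mathrm{Top}(\Gamma)$. Then $H^n(\mathcal{F})=0$ for all $n\geq 2$, and there is a natural exact sequence $$0 \rightarrow H^0(\mathcal{F}) \rightarrow \Gamma (C^{0}\mathcal{F})\xrightarrow{\ \delta\ }\Gamma (C^{1}\mathcal{F}) \rightarrow H^1(\mathcal{F}) \rightarrow 0,$$ where $C^0\mathcal{F}\to C^1\mathcal{F}$ are the first two terms of the Godement resolution of $\mathcal{F}$ and $\delta$ is the induced map on global sections.
   Context: Sheaves are sheaves of abelian groups (or of modules over a ring). $T$ is a compact torus and $\Lambda=\mathrm{Hom}(T,S^1)$. Weights $\alpha,\beta\in\Lambda$ are projectively equivalent if $\alpha^n=\beta^m$ for some non-zero integers $m,n$; $\mathbb{P}(\Lambda)$ is the set of non-trivial weights modulo projective equivalence. A GKM-hypergraph $\Gamma$ consists of a finite set $\mathcal{V}$ of vertices and, for each $\alpha\in\mathbb{P}(\Lambda)$, an equivalence relation $\sim_\alpha$ on $\mathcal{V}$. Its set of hyperedges is $\mathcal{E}=\{(S,\alpha): \alpha\in\mathbb{P}(\Lambda),\ S\subseteq\mathcal{V}\text{ an equivalence class of }\sim_\alpha\}$; for $e=(S,\alpha)$ put $I(e)=S$. $\mathrm{Top}(\Gamma)$ is the topological space with underlying set $\mathcal{V}\cup\mathcal{E}$ whose topology is generated by the basic open sets $U_v=\{v\}$ ($v\in\mathcal{V}$) and $U_e=\{e\}\cup I(e)$ ($e\in\mathcal{E}$). Godement resolution: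 for a sheaf $\mathcal{F}$ on a space $Y$, $C^0\mathcal{F}$ is the sheaf $U\mapsto\prod_{y\in U}\mathcal{F}_y$ with restrictions given by projection, and $\mathcal{F}\to C^0\mathcal{F}$ is the natural monomorphism $s\mapsto (s_y)_{y\in U}$. Put $\mathcal{F}^0=\mathcal{F}$, let $\mathcal{F}^{n}$ be the cokernel sheaf of $\mathcal{F}^{n-1}\to C^0\mathcal{F}^{n-1}$ for $n\ge1$, and $C^n\mathcal{F}=C^0\mathcal{F}^n$. The differential $d_n:C^n\mathcal{F}\to C^{n+1}\mathcal{F}$ is the composite $C^n\mathcal{F}\to\mathcal{F}^{n+1}\to C^{n+1}\mathcal{F}$. $\Gamma(-)$ applied to a sheaf denotes global sections, and $H^n(\mathcal{F})$ is the degree $n$ cohomology of the complex $\Gamma(C^0\mathcal{F})\to\Gamma(C^1\mathcal{F})\to\cdots$. The map $\delta$ is $d_0$ on global sections. *)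

theory Defs
  imports "HOL-Analysis.Analysis" "HOL-Algebra.Module" "HOL-Algebra.AbelCoset" "HOL-Algebra.Product_Groups"
begin

section \<open>Coefficients: abelian groups, or modules over a ring\<close>

text \<open>
  A coefficient category is given by \<open>K :: 'r ring option\<close>: \<open>None\<close> stands for abelian groups and
  \<open>Some R\<close> for left modules over the (not necessarily commutative) ring \<open>R\<close>. Objects of both
  kinds live in the library record \<open>('r, 'a) module\<close>, whose fields \<open>mult\<close> and \<open>one\<close> play no role;
  for \<open>None\<close> the field \<open>smult\<close> plays no role either. The library's locale \<open>module\<close>
  assumes a commutative ring; \<open>module_axioms\<close> are its remaining axioms, which are those
  of a left module.
\<close>

definition coeff_object :: "'r ring option \<Rightarrow> ('r, 'a) module \<Rightarrow> bool" where
  "coeff_object K M \<longleftrightarrow>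
     abelian_group M \<and> (\<forall>R. K = Some R \<longrightarrow> ring R \<and> module_axioms R M)"

definition coeff_hom ::
    "'r ring option \<Rightarrow> ('r, 'a) module \<Rightarrow> ('r, 'b) module \<Rightarrow> ('a \<Rightarrow> 'b) set" where
  "coeff_hom K M N =
     {f \<in> hom (add_monoid M) (add_monoid N).
        \<forall>R. K = Some R \<longrightarrow>
          (\<forall>r\<in>carrier R. \<forall>x\<in>carrier M. f (r \<odot>\<^bsub>M\<^esub> x) = r \<odot>\<^bsub>N\<^esub> f x)}"

definition mk_module ::
    "'a set \<Rightarrow> ('a \<Rightarrow> 'a \<Rightarrow> 'a) \<Rightarrow> 'a \<Rightarrow> ('r \<Rightarrow> 'a \<Rightarrow> 'a) \<Rightarrow> ('r, 'a) module" where
  "mk_module A p z s =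
     \<lparr>carrier = A, monoid.mult = undefined, one = undefined, ring.zero = z, add = p, smult = s\<rparr>"

definition quot_module :: "('r, 'a) module \<Rightarrow> 'a set \<Rightarrow> ('r, 'a set) module" where
  "quot_module M N =
     mk_module (a_rcosets\<^bsub>M\<^esub> N) (\<lambda>c c'. c <+>\<^bsub>M\<^esub> c') N (\<lambda>r c. \<Union>x\<in>c. N +>\<^bsub>M\<^esub> (r \<odot>\<^bsub>M\<^esub> x))"

definition quot_map :: "('r, 'b) module \<Rightarrow> 'b set \<Rightarrow> ('a \<Rightarrow> 'b) \<Rightarrow> 'a set \<Rightarrow> 'b set" where
  "quot_map M N f c = (\<Union>x\<in>c. N +>\<^bsub>M\<^esub> f x)"

text \<open>Exactness of \<open>0 \<rightarrow> A \<rightarrow> B \<rightarrow> C \<rightarrow> D \<rightarrow> 0\<close>.\<close>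

definition exact4 ::
    "'r ring option \<Rightarrow> ('r, 'a) module \<Rightarrow> ('a \<Rightarrow> 'b) \<Rightarrow> ('r, 'b) module \<Rightarrow> ('b \<Rightarrow> 'c) \<Rightarrow>
     ('r, 'c) module \<Rightarrow> ('c \<Rightarrow> 'd) \<Rightarrow> ('r, 'd) module \<Rightarrow> bool" where
  "exact4 K A f B g C h D \<longleftrightarrow>
     coeff_object K A \<and> coeff_object K B \<and> coeff_object K C \<and> coeff_object K D \<and>
     f \<in> coeff_hom K A B \<and> g \<in> coeff_hom K B C \<and> h \<in> coeff_hom K C D \<and>
     a_kernel A B f = {\<zero>\<^bsub>A\<^esub>} \<and>
     f ` carrier A = a_kernel B C g \<and>
     g ` carrier B = a_kernel C D h \<and>
     h ` carrier C = carrier D"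


section \<open>Sheaves\<close>

record ('p, 'r, 'a) presheaf =
  sec :: "'p set \<Rightarrow> ('r, 'a) module"
  restr :: "'p set \<Rightarrow> 'p set \<Rightarrow> 'a \<Rightarrow> 'a"

definition presheaf :: "'r ring option \<Rightarrow> 'p topology \<Rightarrow> ('p, 'r, 'a) presheaf \<Rightarrow> bool" where
  "presheaf K X F \<longleftrightarrow>
     (\<forall>U. openin X U \<longrightarrow> coeff_object K (sec F U)) \<and>
     (\<forall>U V. openin X U \<longrightarrow> openin X V \<longrightarrow> V \<subseteq> U \<longrightarrow>
        restr F U V \<in> coeff_hom K (sec F U) (sec F V)) \<and>
     (\<forall>U. openin X U \<longrightarrow> (\<forall>s\<in>carrier (sec F U). restr F U U s = s)) \<and>
     (\<forall>U V W. openin X U \<longrightarrow> openin X V \<longrightarrow> openin X W \<longrightarrow> W \<subseteq> V \<longrightarrow> V \<subseteq> U \<longrightarrow>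
        (\<forall>s\<in>carrier (sec F U). restr F V W (restr F U V s) = restr F U W s))"

definition sheaf :: "'r ring option \<Rightarrow> 'p topology \<Rightarrow> ('p, 'r, 'a) presheaf \<Rightarrow> bool" where
  "sheaf K X F \<longleftrightarrow>
     presheaf K X F \<and>
     (\<forall>\<U>. (\<forall>V\<in>\<U>. openin X V) \<longrightarrow>
        (\<forall>s\<in>carrier (sec F (\<Union>\<U>)). \<forall>t\<in>carrier (sec F (\<Union>\<U>)).
           (\<forall>V\<in>\<U>. restr F (\<Union>\<U>) V s = restr F (\<Union>\<U>) V t) \<longrightarrow> s = t) \<and>
        (\<forall>\<sigma>. (\<forall>V\<in>\<U>. \<sigma> V \<in> carrier (sec F V)) \<longrightarrow>
           (\<forall>V\<in>\<U>. \<forall>W\<in>\<U>. restr F V (V \<inter> W) (\<sigma> V) = restr F W (V \<inter> W) (\<sigma> W)) \<longrightarrow>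
           (\<exists>s\<in>carrier (sec F (\<Union>\<U>)). \<forall>V\<in>\<U>. restr F (\<Union>\<U>) V s = \<sigma> V)))"

definition sheaf_morphism ::
    "'r ring option \<Rightarrow> 'p topology \<Rightarrow> ('p, 'r, 'a) presheaf \<Rightarrow> ('p, 'r, 'b) presheaf \<Rightarrow>
     ('p set \<Rightarrow> 'a \<Rightarrow> 'b) \<Rightarrow> bool" where
  "sheaf_morphism K X F G \<phi> \<longleftrightarrow>
     (\<forall>U. openin X U \<longrightarrow> \<phi> U \<in> coeff_hom K (sec F U) (sec G U)) \<and>
     (\<forall>U V. openin X U \<longrightarrow> openin X V \<longrightarrow> V \<subseteq> U \<longrightarrow>
        (\<forall>s\<in>carrier (sec F U). \<phi> V (restr F U V s) = restr G U V (\<phi> U s)))"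

definition germ_rel ::
    "'p topology \<Rightarrow> ('p, 'r, 'a) presheaf \<Rightarrow> 'p \<Rightarrow> (('p set \<times> 'a) \<times> ('p set \<times> 'a)) set" where
  "germ_rel X F y =
     {((U, s), (V, t)).
        openin X U \<and> y \<in> U \<and> s \<in> carrier (sec F U) \<and>
        openin X V \<and> y \<in> V \<and> t \<in> carrier (sec F V) \<and>
        (\<exists>W. openin X W \<and> y \<in> W \<and> W \<subseteq> U \<inter> V \<and> restr F U W s = restr F V W t)}"

definition germ ::
    "'p topology \<Rightarrow> ('p, 'r, 'a) presheaf \<Rightarrow> 'p \<Rightarrow> 'p set \<Rightarrow> 'a \<Rightarrow> ('p set \<times> 'a) set" where
  "germ X F y U s = germ_rel X F y `` {(U, s)}"

text \<open>
  Operations on germs are given on representatives; the unions are over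
  equal sets, so each of them is a single germ.
\<close>

definition stalk ::
    "'p topology \<Rightarrow> ('p, 'r, 'a) presheaf \<Rightarrow> 'p \<Rightarrow> ('r, ('p set \<times> 'a) set) module" where
  "stalk X F y =
     mk_module
       {germ X F y U s | U s. openin X U \<and> y \<in> U \<and> s \<in> carrier (sec F U)}
       (\<lambda>a b. \<Union>(U, s)\<in>a. \<Union>(V, t)\<in>b.
          germ X F y (U \<inter> V)
            (restr F U (U \<inter> V) s \<oplus>\<^bsub>sec F (U \<inter> V)\<^esub> restr F V (U \<inter> V) t))
       (germ X F y (topspace X) \<zero>\<^bsub>sec F (topspace X)\<^esub>)
       (\<lambda>r a. \<Union>(U, s)\<in>a. germ X F y U (r \<odot>\<^bsub>sec F U\<^esub> s))"

definition stalk_map ::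
    "'p topology \<Rightarrow> ('p, 'r, 'b) presheaf \<Rightarrow> ('p set \<Rightarrow> 'a \<Rightarrow> 'b) \<Rightarrow> 'p \<Rightarrow>
     ('p set \<times> 'a) set \<Rightarrow> ('p set \<times> 'b) set" where
  "stalk_map X G \<phi> y a = (\<Union>(U, s)\<in>a. germ X G y U (\<phi> U s))"

definition C0 ::
    "'p topology \<Rightarrow> ('p, 'r, 'a) presheaf \<Rightarrow> ('p, 'r, 'p \<Rightarrow> ('p set \<times> 'a) set) presheaf" where
  "C0 X F =
     \<lparr>sec = (\<lambda>U. mk_module
        (\<Pi>\<^sub>E y\<in>U. carrier (stalk X F y))
        (\<lambda>\<sigma> \<tau>. \<lambda>y\<in>U. \<sigma> y \<oplus>\<^bsub>stalk X F y\<^esub> \<tau> y)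
        (\<lambda>y\<in>U. \<zero>\<^bsub>stalk X F y\<^esub>)
        (\<lambda>r \<sigma>. \<lambda>y\<in>U. r \<odot>\<^bsub>stalk X F y\<^esub> \<sigma> y)),
      restr = (\<lambda>U V \<sigma>. restrict \<sigma> V)\<rparr>"

definition C0_unit ::
    "'p topology \<Rightarrow> ('p, 'r, 'a) presheaf \<Rightarrow> 'p set \<Rightarrow> 'a \<Rightarrow> 'p \<Rightarrow> ('p set \<times> 'a) set" where
  "C0_unit X F U s = (\<lambda>y\<in>U. germ X F y U s)"

definition C0_map ::
    "'p topology \<Rightarrow> ('p, 'r, 'b) presheaf \<Rightarrow> ('p set \<Rightarrow> 'a \<Rightarrow> 'b) \<Rightarrow> 'p set \<Rightarrow>
     ('p \<Rightarrow> ('p set \<times> 'a) set) \<Rightarrow> 'p \<Rightarrow> ('p set \<times> 'b) set" where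
  "C0_map X G \<phi> U \<sigma> = (\<lambda>y\<in>U. stalk_map X G \<phi> y (\<sigma> y))"

text \<open>
  The sheafification of \<open>P\<close> is the subsheaf of \<open>C0 X P\<close> of those families of germs that locally come
  from a section of \<open>P\<close>. Thus \<open>C0_unit X P\<close> is also the canonical map from \<open>P\<close> to its
  sheafification, and \<open>C0_map\<close> also gives the action of sheafification on morphisms.
\<close>

definition sheafify ::
    "'p topology \<Rightarrow> ('p, 'r, 'a) presheaf \<Rightarrow> ('p, 'r, 'p \<Rightarrow> ('p set \<times> 'a) set) presheaf" where
  "sheafify X P =
     \<lparr>sec = (\<lambda>U. (sec (C0 X P) U)\<lparr>carrier :=
        {\<sigma> \<in> carrier (sec (C0 X P) U).
           \<forall>y\<in>U. \<exists>V s. openin X V \<and> y \<in> V \<and> V \<subseteq> U \<and> s \<in> carrier (sec P V) \<and>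
             (\<forall>z\<in>V. \<sigma> z = germ X P z V s)}\<rparr>),
      restr = restr (C0 X P)\<rparr>"

definition coker_presheaf ::
    "('p, 'r, 'a) presheaf \<Rightarrow> ('p, 'r, 'b) presheaf \<Rightarrow> ('p set \<Rightarrow> 'a \<Rightarrow> 'b) \<Rightarrow>
     ('p, 'r, 'b set) presheaf" where
  "coker_presheaf A B \<phi> =
     \<lparr>sec = (\<lambda>U. quot_module (sec B U) (\<phi> U ` carrier (sec A U))),
      restr = (\<lambda>U V. quot_map (sec B V) (\<phi> V ` carrier (sec A V)) (restr B U V))\<rparr>"

definition coker_sheaf ::
    "'p topology \<Rightarrow> ('p, 'r, 'a) presheaf \<Rightarrow> ('p, 'r, 'b) presheaf \<Rightarrow> ('p set \<Rightarrow> 'a \<Rightarrow> 'b) \<Rightarrow>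
     ('p, 'r, 'p \<Rightarrow> ('p set \<times> 'b set) set) presheaf" where
  "coker_sheaf X A B \<phi> = sheafify X (coker_presheaf A B \<phi>)"

definition coker_proj ::
    "'p topology \<Rightarrow> ('p, 'r, 'a) presheaf \<Rightarrow> ('p, 'r, 'b) presheaf \<Rightarrow> ('p set \<Rightarrow> 'a \<Rightarrow> 'b) \<Rightarrow>
     'p set \<Rightarrow> 'b \<Rightarrow> 'p \<Rightarrow> ('p set \<times> 'b set) set" where
  "coker_proj X A B \<phi> U x =
     C0_unit X (coker_presheaf A B \<phi>) U (\<phi> U ` carrier (sec A U) +>\<^bsub>sec B U\<^esub> x)"


section \<open>The Godement resolution\<close>

text \<open>
  The cokernel sheaf of \<open>F \<rightarrow> C0 X F\<close> has sections of a larger type than \<open>F\<close>, so the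
  construction cannot be iterated verbatim. We transport it in each step to the type \<open>god\<close> along
  \<open>god_encode\<close>, which replaces every equivalence class (coset or germ) by a chosen
  representative. Distinct classes are disjoint, so \<open>god_encode\<close> is injective on the sections
  over each open set, and the transported sheaf is an isomorphic copy.
\<close>

datatype ('p, 'a) god =
    Base 'a
  | Step "'p \<Rightarrow> 'p set \<times> ('p \<Rightarrow> 'p set \<times> ('p, 'a) god)"

definition rep :: "'a set \<Rightarrow> 'a" where
  "rep A = (SOME a. a \<in> A)"

definition god_encode ::
    "('p \<Rightarrow> ('p set \<times> ('p \<Rightarrow> ('p set \<times> ('p, 'a) god) set) set) set) \<Rightarrow> ('p, 'a) god" where
  "god_encode \<sigma> = Step (\<lambda>y. case rep (\<sigma> y) of (U, c) \<Rightarrow> (U, \<lambda>x. rep (rep c x)))"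

definition transport :: "('a \<Rightarrow> 'b) \<Rightarrow> ('p, 'r, 'a) presheaf \<Rightarrow> ('p, 'r, 'b) presheaf" where
  "transport e F =
     \<lparr>sec = (\<lambda>U. let d = inv_into (carrier (sec F U)) e in mk_module
        (e ` carrier (sec F U))
        (\<lambda>a b. e (d a \<oplus>\<^bsub>sec F U\<^esub> d b))
        (e \<zero>\<^bsub>sec F U\<^esub>)
        (\<lambda>r a. e (r \<odot>\<^bsub>sec F U\<^esub> d a))),
      restr = (\<lambda>U V a. e (restr F U V (inv_into (carrier (sec F U)) e a)))\<rparr>"

definition transport_map ::
    "('a \<Rightarrow> 'b) \<Rightarrow> ('c \<Rightarrow> 'd) \<Rightarrow> ('p, 'r, 'a) presheaf \<Rightarrow> ('p set \<Rightarrow> 'a \<Rightarrow> 'c) \<Rightarrow>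
     'p set \<Rightarrow> 'b \<Rightarrow> 'd" where
  "transport_map e e' F \<phi> U a = e' (\<phi> U (inv_into (carrier (sec F U)) e a))"

text \<open>\<open>god_sheaf X F n\<close> is \<open>\<F>\<^sup>n\<close> and \<open>god_C X F n\<close> is \<open>C\<^sup>n\<F>\<close>.\<close>

primrec god_sheaf ::
    "'p topology \<Rightarrow> ('p, 'r, 'a) presheaf \<Rightarrow> nat \<Rightarrow> ('p, 'r, ('p, 'a) god) presheaf" where
  "god_sheaf X F 0 = transport Base F"
| "god_sheaf X F (Suc n) =
     transport god_encode
       (coker_sheaf X (god_sheaf X F n) (C0 X (god_sheaf X F n)) (C0_unit X (god_sheaf X F n)))"

definition god_C ::
    "'p topology \<Rightarrow> ('p, 'r, 'a) presheaf \<Rightarrow> nat \<Rightarrow>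
     ('p, 'r, 'p \<Rightarrow> ('p set \<times> ('p, 'a) god) set) presheaf" where
  "god_C X F n = C0 X (god_sheaf X F n)"

definition god_d ::
    "'p topology \<Rightarrow> ('p, 'r, 'a) presheaf \<Rightarrow> nat \<Rightarrow> 'p set \<Rightarrow>
     ('p \<Rightarrow> ('p set \<times> ('p, 'a) god) set) \<Rightarrow> 'p \<Rightarrow> ('p set \<times> ('p, 'a) god) set" where
  "god_d X F n U \<sigma> =
     C0_unit X (god_sheaf X F (Suc n)) U
       (god_encode
         (coker_proj X (god_sheaf X F n) (god_C X F n) (C0_unit X (god_sheaf X F n)) U \<sigma>))"

definition god_global ::
    "'p topology \<Rightarrow> ('p, 'r, 'a) presheaf \<Rightarrow> nat \<Rightarrow>
     ('r, 'p \<Rightarrow> ('p set \<times> ('p, 'a) god) set) module" where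
  "god_global X F n = sec (god_C X F n) (topspace X)"

definition god_delta ::
    "'p topology \<Rightarrow> ('p, 'r, 'a) presheaf \<Rightarrow> nat \<Rightarrow>
     ('p \<Rightarrow> ('p set \<times> ('p, 'a) god) set) \<Rightarrow> 'p \<Rightarrow> ('p set \<times> ('p, 'a) god) set" where
  "god_delta X F n = god_d X F n (topspace X)"

definition god_cocycles ::
    "'p topology \<Rightarrow> ('p, 'r, 'a) presheaf \<Rightarrow> nat \<Rightarrow> ('p \<Rightarrow> ('p set \<times> ('p, 'a) god) set) set" where
  "god_cocycles X F n =
     a_kernel (god_global X F n) (god_global X F (Suc n)) (god_delta X F n)"

definition god_coboundaries ::
    "'p topology \<Rightarrow> ('p, 'r, 'a) presheaf \<Rightarrow> nat \<Rightarrow> ('p \<Rightarrow> ('p set \<times> ('p, 'a) god) set) set" where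
  "god_coboundaries X F n =
     (case n of 0 \<Rightarrow> {\<zero>\<^bsub>god_global X F 0\<^esub>}
      | Suc m \<Rightarrow> god_delta X F m ` carrier (god_global X F m))"

definition sheaf_cohom ::
    "'p topology \<Rightarrow> ('p, 'r, 'a) presheaf \<Rightarrow> nat \<Rightarrow>
     ('r, ('p \<Rightarrow> ('p set \<times> ('p, 'a) god) set) set) module" where
  "sheaf_cohom X F n =
     quot_module ((god_global X F n)\<lparr>carrier := god_cocycles X F n\<rparr>) (god_coboundaries X F n)"

text \<open>
  The canonical maps \<open>H\<^sup>0(\<F>) \<rightarrow> \<Gamma>(C\<^sup>0\<F>)\<close> and \<open>\<Gamma>(C\<^sup>1\<F>) \<rightarrow> H\<^sup>1(\<F>)\<close>. As \<open>H\<^sup>0\<close> is the quotient of the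
  kernel of \<open>\<delta>\<close> by the zero subgroup, its elements are singletons. The second map takes
  values in \<open>H\<^sup>1\<close> only if every global section of \<open>C\<^sup>1\<F>\<close> is a cocycle.
\<close>

definition cohom0_incl ::
    "('p \<Rightarrow> ('p set \<times> ('p, 'a) god) set) set \<Rightarrow> 'p \<Rightarrow> ('p set \<times> ('p, 'a) god) set" where
  "cohom0_incl c = the_elem c"

definition cohom1_proj ::
    "'p topology \<Rightarrow> ('p, 'r, 'a) presheaf \<Rightarrow>
     ('p \<Rightarrow> ('p set \<times> ('p, 'a) god) set) \<Rightarrow> ('p \<Rightarrow> ('p set \<times> ('p, 'a) god) set) set" where
  "cohom1_proj X F x = god_coboundaries X F 1 +>\<^bsub>god_global X F 1\<^esub> x"

text \<open>Maps induced by a sheaf morphism \<open>\<phi> : F \<rightarrow> G\<close>.\<close>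

primrec god_sheaf_map ::
    "'p topology \<Rightarrow> ('p, 'r, 'a) presheaf \<Rightarrow> ('p, 'r, 'b) presheaf \<Rightarrow> ('p set \<Rightarrow> 'a \<Rightarrow> 'b) \<Rightarrow>
     nat \<Rightarrow> 'p set \<Rightarrow> ('p, 'a) god \<Rightarrow> ('p, 'b) god" where
  "god_sheaf_map X F G \<phi> 0 = transport_map Base Base F \<phi>"
| "god_sheaf_map X F G \<phi> (Suc n) =
     transport_map god_encode god_encode
       (coker_sheaf X (god_sheaf X F n) (C0 X (god_sheaf X F n)) (C0_unit X (god_sheaf X F n)))
       (C0_map X
         (coker_presheaf (god_sheaf X G n) (C0 X (god_sheaf X G n)) (C0_unit X (god_sheaf X G n)))
         (\<lambda>U. quot_map (sec (C0 X (god_sheaf X G n)) U)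
            (C0_unit X (god_sheaf X G n) U ` carrier (sec (god_sheaf X G n) U))
            (C0_map X (god_sheaf X G n) (god_sheaf_map X F G \<phi> n) U)))"

definition god_global_map ::
    "'p topology \<Rightarrow> ('p, 'r, 'a) presheaf \<Rightarrow> ('p, 'r, 'b) presheaf \<Rightarrow> ('p set \<Rightarrow> 'a \<Rightarrow> 'b) \<Rightarrow>
     nat \<Rightarrow> ('p \<Rightarrow> ('p set \<times> ('p, 'a) god) set) \<Rightarrow> 'p \<Rightarrow> ('p set \<times> ('p, 'b) god) set" where
  "god_global_map X F G \<phi> n =
     C0_map X (god_sheaf X G n) (god_sheaf_map X F G \<phi> n) (topspace X)"

definition sheaf_cohom_map ::
    "'p topology \<Rightarrow> ('p, 'r, 'a) presheaf \<Rightarrow> ('p, 'r, 'b) presheaf \<Rightarrow> ('p set \<Rightarrow> 'a \<Rightarrow> 'b) \<Rightarrow>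
     nat \<Rightarrow> ('p \<Rightarrow> ('p set \<times> ('p, 'a) god) set) set \<Rightarrow> ('p \<Rightarrow> ('p set \<times> ('p, 'b) god) set) set" where
  "sheaf_cohom_map X F G \<phi> n =
     quot_map (god_global X G n) (god_coboundaries X G n) (god_global_map X F G \<phi> n)"


section \<open>GKM-hypergraphs\<close>

definition circle_group :: "complex monoid" where
  "circle_group = \<lparr>carrier = sphere 0 1, monoid.mult = (*), one = 1\<rparr>"

abbreviation circle_top :: "complex topology" where
  "circle_top \<equiv> top_of_set (sphere 0 1)"

text \<open>A topological group isomorphic to \<open>(S\<^sup>1)\<^sup>k\<close> for some \<open>k\<close>; \<open>\<tau>\<close> is the topology of \<open>T\<close>.\<close>

definition compact_torus :: "('t, 'm) monoid_scheme \<Rightarrow> 't topology \<Rightarrow> bool" where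
  "compact_torus T \<tau> \<longleftrightarrow>
     group T \<and> topspace \<tau> = carrier T \<and>
     (\<exists>(k::nat) f. f \<in> iso T (product_group {..<k} (\<lambda>_. circle_group)) \<and>
        homeomorphic_map \<tau> (product_topology (\<lambda>_. circle_top) {..<k}) f)"

definition weights :: "('t, 'm) monoid_scheme \<Rightarrow> 't topology \<Rightarrow> ('t \<Rightarrow> complex) set" where
  "weights T \<tau> =
     {\<alpha> \<in> hom T circle_group \<inter> extensional (carrier T). continuous_map \<tau> circle_top \<alpha>}"

definition nontrivial_weights :: "('t, 'm) monoid_scheme \<Rightarrow> 't topology \<Rightarrow> ('t \<Rightarrow> complex) set" where
  "nontrivial_weights T \<tau> = {\<alpha> \<in> weights T \<tau>. \<exists>t\<in>carrier T. \<alpha> t \<noteq> 1}"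

definition proj_equiv ::
    "('t, 'm) monoid_scheme \<Rightarrow> 't topology \<Rightarrow> (('t \<Rightarrow> complex) \<times> ('t \<Rightarrow> complex)) set" where
  "proj_equiv T \<tau> =
     {(\<alpha>, \<beta>). \<alpha> \<in> nontrivial_weights T \<tau> \<and> \<beta> \<in> nontrivial_weights T \<tau> \<and>
        (\<exists>(n::int) (m::int). n \<noteq> 0 \<and> m \<noteq> 0 \<and> (\<forall>t\<in>carrier T. \<alpha> t powi n = \<beta> t powi m))}"

definition proj_weights :: "('t, 'm) monoid_scheme \<Rightarrow> 't topology \<Rightarrow> ('t \<Rightarrow> complex) set set" where
  "proj_weights T \<tau> = nontrivial_weights T \<tau> // proj_equiv T \<tau>"

text \<open>\<open>'w\<close> is the type of projective weights, \<open>('t \<Rightarrow> complex) set\<close>.\<close>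

record ('v, 'w) hypergraph =
  verts :: "'v set"
  vrel :: "'w \<Rightarrow> ('v \<times> 'v) set"

definition gkm_hypergraph ::
    "('t, 'm) monoid_scheme \<Rightarrow> 't topology \<Rightarrow> ('v, ('t \<Rightarrow> complex) set) hypergraph \<Rightarrow> bool" where
  "gkm_hypergraph T \<tau> \<Gamma> \<longleftrightarrow>
     finite (verts \<Gamma>) \<and> (\<forall>\<alpha>\<in>proj_weights T \<tau>. equiv (verts \<Gamma>) (vrel \<Gamma> \<alpha>))"

definition hyperedges ::
    "('t, 'm) monoid_scheme \<Rightarrow> 't topology \<Rightarrow> ('v, ('t \<Rightarrow> complex) set) hypergraph \<Rightarrow>
     ('v set \<times> ('t \<Rightarrow> complex) set) set" where
  "hyperedges T \<tau> \<Gamma> = {(S, \<alpha>). \<alpha> \<in> proj_weights T \<tau> \<and> S \<in> verts \<Gamma> // vrel \<Gamma> \<alpha>}"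

definition gkm_top ::
    "('t, 'm) monoid_scheme \<Rightarrow> 't topology \<Rightarrow> ('v, ('t \<Rightarrow> complex) set) hypergraph \<Rightarrow>
     ('v + 'v set \<times> ('t \<Rightarrow> complex) set) topology" where
  "gkm_top T \<tau> \<Gamma> = topology_generated_by
     ({{Inl v} | v. v \<in> verts \<Gamma>} \<union>
      {insert (Inr e) (Inl ` fst e) | e. e \<in> hyperedges T \<tau> \<Gamma>})"

end

theory Submission
  imports Defs
begin

text \<open>
  The Godement quotient \<open>C\<^sup>0\<P>/\<P>\<close> has zero stalk at a point \<open>y\<close> as soon as \<open>y\<close> has arbitrarily small
  neighbourhoods on which all stalks of \<open>\<P>\<close> other than the one at \<open>y\<close> vanish. In \<open>Top(\<Gamma>)\<close> the vertices
  are open points, so \<open>\<F>\<^sup>1\<close> is supported on the hyperedges; a hyperedge has a neighbourhood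
  whose other points are vertices, so \<open>\<F>\<^sup>2 = 0\<close>. Hence \<open>C\<^sup>n\<F> = 0\<close> for \<open>n \<ge> 2\<close>, the group \<open>H\<^sup>1\<close> is the cokernel
  of \<open>\<delta>\<close>, and \<open>H\<^sup>0\<close> is its kernel.
\<close>

section \<open>Coefficient objects\<close>

text \<open>\<open>Top(\<Gamma>)\<close> has height one: closures lead only from a vertex to
  hyperedges, and each Godement quotient clears one layer of points, the open ones before the
  others. The obstacle is that the next sheaf of the resolution is not given by its stalks: it is a
  quotient presheaf, then sheafified, then recoded in the type \<open>god\<close>. Vanishing of a
  stalk is therefore restated as "every section becomes zero on a smaller neighbourhood" and carried
  through these operations one at a time. The same layering shapes the functorial half. Maps on
  cosets and germs are unions over representatives, and maps between encoded sheaves use inverses of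
  the encoding, so every naturality square is checked by evaluating on a representative. The exact
  sequence itself is formal, the kernel and cokernel of one homomorphism; the geometry enters
  through the vanishing of the global terms from degree 2 on.\<close>

definition scalars :: "'r ring option \<Rightarrow> 'r set" where
  "scalars K = (case K of None \<Rightarrow> {} | Some R \<Rightarrow> carrier R)"

lemma mk_module_simps [simp]:
  "carrier (mk_module A p z s) = A"
  "x \<oplus>\<^bsub>mk_module A p z s\<^esub> y = p x y"
  "\<zero>\<^bsub>mk_module A p z s\<^esub> = z"
  "r \<odot>\<^bsub>mk_module A p z s\<^esub> x = s r x"
  by (simp_all add: mk_module_def)

text \<open>Since \<open>scalars\<close> is empty for abelian groups, the linearity clause becomes
  vacuous there, and both kinds of coefficients are handled by one statement without case
  distinction.\<close>

lemma coeff_hom_iff: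
  "f \<in> coeff_hom K M N \<longleftrightarrow>
     (\<forall>x\<in>carrier M. f x \<in> carrier N) \<and>
     (\<forall>x\<in>carrier M. \<forall>y\<in>carrier M. f (x \<oplus>\<^bsub>M\<^esub> y) = f x \<oplus>\<^bsub>N\<^esub> f y) \<and>
     (\<forall>r\<in>scalars K. \<forall>x\<in>carrier M. f (r \<odot>\<^bsub>M\<^esub> x) = r \<odot>\<^bsub>N\<^esub> f x)"
  by (auto simp: coeff_hom_def hom_def scalars_def split: option.splits)

lemma coeff_homI:
  assumes "\<And>x. x \<in> carrier M \<Longrightarrow> f x \<in> carrier N"
    and "\<And>x y. x \<in> carrier M \<Longrightarrow> y \<in> carrier M \<Longrightarrow> f (x \<oplus>\<^bsub>M\<^esub> y) = f x \<oplus>\<^bsub>N\<^esub> f y"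
    and "\<And>r x. r \<in> scalars K \<Longrightarrow> x \<in> carrier M \<Longrightarrow> f (r \<odot>\<^bsub>M\<^esub> x) = r \<odot>\<^bsub>N\<^esub> f x"
  shows "f \<in> coeff_hom K M N"
  using assms by (simp add: coeff_hom_iff)

lemma coeff_homD:
  assumes "f \<in> coeff_hom K M N"
  shows "\<And>x. x \<in> carrier M \<Longrightarrow> f x \<in> carrier N"
    and "\<And>x y. x \<in> carrier M \<Longrightarrow> y \<in> carrier M \<Longrightarrow> f (x \<oplus>\<^bsub>M\<^esub> y) = f x \<oplus>\<^bsub>N\<^esub> f y"
    and "\<And>r x. r \<in> scalars K \<Longrightarrow> x \<in> carrier M \<Longrightarrow> f (r \<odot>\<^bsub>M\<^esub> x) = r \<odot>\<^bsub>N\<^esub> f x"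
  using assms by (simp_all add: coeff_hom_iff)

lemma coeff_hom_comp:
  "f \<in> coeff_hom K M N \<Longrightarrow> g \<in> coeff_hom K N L \<Longrightarrow> (\<lambda>x. g (f x)) \<in> coeff_hom K M L"
  by (simp add: coeff_hom_iff)

lemma coeff_object_abelian_group: "coeff_object K M \<Longrightarrow> abelian_group M"
  by (simp add: coeff_object_def)

lemma coeff_object_zero: "coeff_object K M \<Longrightarrow> \<zero>\<^bsub>M\<^esub> \<in> carrier M"
  by (simp add: coeff_object_def abelian_group_def abelian_monoid.zero_closed)

lemma coeff_object_add:
  "coeff_object K M \<Longrightarrow> x \<in> carrier M \<Longrightarrow> y \<in> carrier M \<Longrightarrow> x \<oplus>\<^bsub>M\<^esub> y \<in> carrier M"
  by (simp add: coeff_object_def abelian_group_def abelian_monoid.a_closed)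

lemma coeff_object_minus: "coeff_object K M \<Longrightarrow> x \<in> carrier M \<Longrightarrow> \<ominus>\<^bsub>M\<^esub> x \<in> carrier M"
  by (simp add: coeff_object_def abelian_group.a_inv_closed)

lemma coeff_object_smult:
  "coeff_object K M \<Longrightarrow> r \<in> scalars K \<Longrightarrow> x \<in> carrier M \<Longrightarrow> r \<odot>\<^bsub>M\<^esub> x \<in> carrier M"
  by (auto simp: coeff_object_def module_axioms_def scalars_def split: option.splits)

lemma coeff_object_smult_distr:
  "coeff_object K M \<Longrightarrow> r \<in> scalars K \<Longrightarrow> x \<in> carrier M \<Longrightarrow> y \<in> carrier M \<Longrightarrow>
     r \<odot>\<^bsub>M\<^esub> (x \<oplus>\<^bsub>M\<^esub> y) = r \<odot>\<^bsub>M\<^esub> x \<oplus>\<^bsub>M\<^esub> r \<odot>\<^bsub>M\<^esub> y"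
  by (auto simp: coeff_object_def module_axioms_def scalars_def split: option.splits)

lemmas coeff_object_closed =
  coeff_object_zero coeff_object_add coeff_object_minus coeff_object_smult

lemma coeff_objectI:
  assumes "\<And>x y. x \<in> carrier M \<Longrightarrow> y \<in> carrier M \<Longrightarrow> x \<oplus>\<^bsub>M\<^esub> y \<in> carrier M"
    and "\<zero>\<^bsub>M\<^esub> \<in> carrier M"
    and "\<And>x y z. x \<in> carrier M \<Longrightarrow> y \<in> carrier M \<Longrightarrow> z \<in> carrier M \<Longrightarrow>
           (x \<oplus>\<^bsub>M\<^esub> y) \<oplus>\<^bsub>M\<^esub> z = x \<oplus>\<^bsub>M\<^esub> (y \<oplus>\<^bsub>M\<^esub> z)"
    and "\<And>x y. x \<in> carrier M \<Longrightarrow> y \<in> carrier M \<Longrightarrow> x \<oplus>\<^bsub>M\<^esub> y = y \<oplus>\<^bsub>M\<^esub> x"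
    and "\<And>x. x \<in> carrier M \<Longrightarrow> \<zero>\<^bsub>M\<^esub> \<oplus>\<^bsub>M\<^esub> x = x"
    and "\<And>x. x \<in> carrier M \<Longrightarrow> \<exists>y\<in>carrier M. y \<oplus>\<^bsub>M\<^esub> x = \<zero>\<^bsub>M\<^esub>"
    and "\<And>R. K = Some R \<Longrightarrow> ring R \<and> module_axioms R M"
  shows "coeff_object K M"
  unfolding coeff_object_def using assms by (intro conjI abelian_groupI) auto

text \<open>
  Every axiom of a coefficient object involves at most three elements, so it may be checked in
  homomorphic images of coefficient objects that contain them. This covers quotients, direct limits
  (stalks) and structures transported along a bijection.
\<close>

lemma coeff_object_local_image:
  fixes N :: "('r, 'a) module"
  assumes zero: "\<zero>\<^bsub>N\<^esub> \<in> carrier N"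
    and loc: "\<And>x y z. x \<in> carrier N \<Longrightarrow> y \<in> carrier N \<Longrightarrow> z \<in> carrier N \<Longrightarrow>
      \<exists>(M :: ('r, 'b) module) p. coeff_object K M \<and> p \<in> coeff_hom K M N \<and> p \<zero>\<^bsub>M\<^esub> = \<zero>\<^bsub>N\<^esub> \<and>
        {x, y, z} \<subseteq> p ` carrier M"
  shows "coeff_object K N"
proof -
  \<comment> \<open>\<open>N\<close> is not yet known to be a group, so p 0 = 0 is demanded of the
    witness and not deduced. Axioms in fewer than three variables repeat an element to fill the
    three slots.\<close>
  have loc': thesis
    if "x \<in> carrier N" "y \<in> carrier N" "z \<in> carrier N"
      and "\<And>(M :: ('r, 'b) module) p a b c. coeff_object K M \<Longrightarrow> p \<in> coeff_hom K M N \<Longrightarrow>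
        p \<zero>\<^bsub>M\<^esub> = \<zero>\<^bsub>N\<^esub> \<Longrightarrow> a \<in> carrier M \<Longrightarrow> b \<in> carrier M \<Longrightarrow> c \<in> carrier M \<Longrightarrow>
        x = p a \<Longrightarrow> y = p b \<Longrightarrow> z = p c \<Longrightarrow> thesis"
    for x y z thesis
    using loc[OF that(1-3)] that(4) by (auto simp: image_iff)
  show ?thesis
  proof (rule coeff_objectI)
    fix x y assume xy: "x \<in> carrier N" "y \<in> carrier N"
    show "x \<oplus>\<^bsub>N\<^esub> y \<in> carrier N"
    proof (rule loc'[OF xy xy(2)])
      fix M :: "('r, 'b) module" and p a b
      assume *: "coeff_object K M" "p \<in> coeff_hom K M N" "p \<zero>\<^bsub>M\<^esub> = \<zero>\<^bsub>N\<^esub>"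
        "a \<in> carrier M" "b \<in> carrier M" "x = p a" "y = p b"
      then have "p (a \<oplus>\<^bsub>M\<^esub> b) \<in> carrier N"
        by (simp add: coeff_homD(1)[OF *(2)] coeff_object_add)
      then show ?thesis using * by (simp add: coeff_homD(2)[OF *(2)])
    qed
    show "x \<oplus>\<^bsub>N\<^esub> y = y \<oplus>\<^bsub>N\<^esub> x"
    proof (rule loc'[OF xy xy(2)])
      fix M :: "('r, 'b) module" and p a b
      assume *: "coeff_object K M" "p \<in> coeff_hom K M N" "p \<zero>\<^bsub>M\<^esub> = \<zero>\<^bsub>N\<^esub>"
        "a \<in> carrier M" "b \<in> carrier M" "x = p a" "y = p b"
      have "a \<oplus>\<^bsub>M\<^esub> b = b \<oplus>\<^bsub>M\<^esub> a"
        using * by (simp add: coeff_object_def abelian_group_def abelian_monoid.a_comm)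
      then have "p (a \<oplus>\<^bsub>M\<^esub> b) = p (b \<oplus>\<^bsub>M\<^esub> a)" by simp
      then show ?thesis using * by (simp add: coeff_homD(2)[OF *(2)])
    qed
  next
    show "\<zero>\<^bsub>N\<^esub> \<in> carrier N" by (rule zero)
  next
    fix x y z assume xyz: "x \<in> carrier N" "y \<in> carrier N" "z \<in> carrier N"
    show "(x \<oplus>\<^bsub>N\<^esub> y) \<oplus>\<^bsub>N\<^esub> z = x \<oplus>\<^bsub>N\<^esub> (y \<oplus>\<^bsub>N\<^esub> z)"
    proof (rule loc'[OF xyz])
      fix M :: "('r, 'b) module" and p a b c
      assume *: "coeff_object K M" "p \<in> coeff_hom K M N"
        "a \<in> carrier M" "b \<in> carrier M" "c \<in> carrier M" "x = p a" "y = p b" "z = p c"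
      have "(a \<oplus>\<^bsub>M\<^esub> b) \<oplus>\<^bsub>M\<^esub> c = a \<oplus>\<^bsub>M\<^esub> (b \<oplus>\<^bsub>M\<^esub> c)"
        using * by (simp add: coeff_object_def abelian_group_def abelian_monoid.a_assoc)
      then have "p ((a \<oplus>\<^bsub>M\<^esub> b) \<oplus>\<^bsub>M\<^esub> c) = p (a \<oplus>\<^bsub>M\<^esub> (b \<oplus>\<^bsub>M\<^esub> c))" by simp
      then show ?thesis
        using * by (simp add: coeff_homD(2)[OF *(2)] coeff_object_closed)
    qed
  next
    fix x assume x: "x \<in> carrier N"
    show "\<zero>\<^bsub>N\<^esub> \<oplus>\<^bsub>N\<^esub> x = x"
    proof (rule loc'[OF x x x])
      fix M :: "('r, 'b) module" and p a
      assume *: "coeff_object K M" "p \<in> coeff_hom K M N" "p \<zero>\<^bsub>M\<^esub> = \<zero>\<^bsub>N\<^esub>"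
        "a \<in> carrier M" "x = p a"
      have "\<zero>\<^bsub>M\<^esub> \<oplus>\<^bsub>M\<^esub> a = a"
        using * by (simp add: coeff_object_def abelian_group_def abelian_monoid.l_zero)
      then have "p (\<zero>\<^bsub>M\<^esub> \<oplus>\<^bsub>M\<^esub> a) = p a" by simp
      then show ?thesis using * by (simp add: coeff_homD(2)[OF *(2)] coeff_object_zero)
    qed
    show "\<exists>y\<in>carrier N. y \<oplus>\<^bsub>N\<^esub> x = \<zero>\<^bsub>N\<^esub>"
    proof (rule loc'[OF x x x])
      fix M :: "('r, 'b) module" and p a
      assume *: "coeff_object K M" "p \<in> coeff_hom K M N" "p \<zero>\<^bsub>M\<^esub> = \<zero>\<^bsub>N\<^esub>"
        "a \<in> carrier M" "x = p a"
      have "\<ominus>\<^bsub>M\<^esub> a \<oplus>\<^bsub>M\<^esub> a = \<zero>\<^bsub>M\<^esub>"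
        using * by (simp add: coeff_object_def abelian_group.l_neg)
      then have "p (\<ominus>\<^bsub>M\<^esub> a \<oplus>\<^bsub>M\<^esub> a) = p \<zero>\<^bsub>M\<^esub>" by simp
      then show ?thesis using *
        by (intro bexI[of _ "p (\<ominus>\<^bsub>M\<^esub> a)"])
          (simp_all add: coeff_homD(1,2)[OF *(2)] coeff_object_minus)
    qed
  next
    fix R assume K: "K = Some R"
    then have sc: "scalars K = carrier R" by (simp add: scalars_def)
    \<comment> \<open>That \<open>R\<close> is a ring is part of being a coefficient object, so any
      witness supplies it; the zero of \<open>N\<close> guarantees that there is one.\<close>
    from loc[OF zero zero zero] have R: "ring R" using K by (auto simp: coeff_object_def)
    have "module_axioms R N"
    proof
      fix r x assume rx: "r \<in> carrier R" "x \<in> carrier N"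
      show "r \<odot>\<^bsub>N\<^esub> x \<in> carrier N"
      proof (rule loc'[OF rx(2) rx(2) rx(2)])
        fix M :: "('r, 'b) module" and p a
        assume *: "coeff_object K M" "p \<in> coeff_hom K M N" "a \<in> carrier M" "x = p a"
        then have "p (r \<odot>\<^bsub>M\<^esub> a) \<in> carrier N"
          using rx by (simp add: coeff_homD(1)[OF *(2)] coeff_object_smult sc)
        then show ?thesis using * rx by (simp add: coeff_homD(3)[OF *(2)] sc)
      qed
    next
      fix r r' x assume rx: "r \<in> carrier R" "r' \<in> carrier R" "x \<in> carrier N"
      have rr: "r \<oplus>\<^bsub>R\<^esub> r' \<in> carrier R" "r \<otimes>\<^bsub>R\<^esub> r' \<in> carrier R"
        using R rx by (auto simp: ring.ring_simprules)
      show "(r \<oplus>\<^bsub>R\<^esub> r') \<odot>\<^bsub>N\<^esub> x = r \<odot>\<^bsub>N\<^esub> x \<oplus>\<^bsub>N\<^esub> r' \<odot>\<^bsub>N\<^esub> x"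
      proof (rule loc'[OF rx(3) rx(3) rx(3)])
        fix M :: "('r, 'b) module" and p a
        assume *: "coeff_object K M" "p \<in> coeff_hom K M N" "a \<in> carrier M" "x = p a"
        have "(r \<oplus>\<^bsub>R\<^esub> r') \<odot>\<^bsub>M\<^esub> a = r \<odot>\<^bsub>M\<^esub> a \<oplus>\<^bsub>M\<^esub> r' \<odot>\<^bsub>M\<^esub> a"
          using * K rx by (auto simp: coeff_object_def module_axioms_def)
        then have "p ((r \<oplus>\<^bsub>R\<^esub> r') \<odot>\<^bsub>M\<^esub> a) = p (r \<odot>\<^bsub>M\<^esub> a \<oplus>\<^bsub>M\<^esub> r' \<odot>\<^bsub>M\<^esub> a)" by simp
        then show ?thesis
          using * rx rr by (simp add: coeff_homD(2,3)[OF *(2)] coeff_object_closed sc)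
      qed
      show "(r \<otimes>\<^bsub>R\<^esub> r') \<odot>\<^bsub>N\<^esub> x = r \<odot>\<^bsub>N\<^esub> (r' \<odot>\<^bsub>N\<^esub> x)"
      proof (rule loc'[OF rx(3) rx(3) rx(3)])
        fix M :: "('r, 'b) module" and p a
        assume *: "coeff_object K M" "p \<in> coeff_hom K M N" "a \<in> carrier M" "x = p a"
        have "(r \<otimes>\<^bsub>R\<^esub> r') \<odot>\<^bsub>M\<^esub> a = r \<odot>\<^bsub>M\<^esub> (r' \<odot>\<^bsub>M\<^esub> a)"
          using * K rx by (auto simp: coeff_object_def module_axioms_def)
        then have "p ((r \<otimes>\<^bsub>R\<^esub> r') \<odot>\<^bsub>M\<^esub> a) = p (r \<odot>\<^bsub>M\<^esub> (r' \<odot>\<^bsub>M\<^esub> a))" by simp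
        then show ?thesis
          using * rx rr by (simp add: coeff_homD(2,3)[OF *(2)] coeff_object_closed sc)
      qed
    next
      fix r x y assume rx: "r \<in> carrier R" "x \<in> carrier N" "y \<in> carrier N"
      show "r \<odot>\<^bsub>N\<^esub> (x \<oplus>\<^bsub>N\<^esub> y) = r \<odot>\<^bsub>N\<^esub> x \<oplus>\<^bsub>N\<^esub> r \<odot>\<^bsub>N\<^esub> y"
      proof (rule loc'[OF rx(2) rx(3) rx(3)])
        fix M :: "('r, 'b) module" and p a b
        assume *: "coeff_object K M" "p \<in> coeff_hom K M N" "a \<in> carrier M" "x = p a"
          "b \<in> carrier M" "y = p b"
        have "r \<odot>\<^bsub>M\<^esub> (a \<oplus>\<^bsub>M\<^esub> b) = r \<odot>\<^bsub>M\<^esub> a \<oplus>\<^bsub>M\<^esub> r \<odot>\<^bsub>M\<^esub> b"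
          using * rx by (simp add: coeff_object_smult_distr sc)
        then have "p (r \<odot>\<^bsub>M\<^esub> (a \<oplus>\<^bsub>M\<^esub> b)) = p (r \<odot>\<^bsub>M\<^esub> a \<oplus>\<^bsub>M\<^esub> r \<odot>\<^bsub>M\<^esub> b)" by simp
        then show ?thesis
          using * rx by (simp add: coeff_homD(2,3)[OF *(2)] coeff_object_closed sc)
      qed
    next
      fix x assume x: "x \<in> carrier N"
      show "\<one>\<^bsub>R\<^esub> \<odot>\<^bsub>N\<^esub> x = x"
      proof (rule loc'[OF x x x])
        fix M :: "('r, 'b) module" and p a
        assume *: "coeff_object K M" "p \<in> coeff_hom K M N" "a \<in> carrier M" "x = p a"
        have "\<one>\<^bsub>R\<^esub> \<odot>\<^bsub>M\<^esub> a = a" using * K by (auto simp: coeff_object_def module_axioms_def)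
        then show ?thesis
          using * R coeff_homD(3)[OF *(2), of "\<one>\<^bsub>R\<^esub>" a] by (simp add: sc ring.ring_simprules)
      qed
    qed
    with R show "ring R \<and> module_axioms R N" ..
  qed
qed

lemma coeff_object_image:
  assumes "coeff_object K M" "p \<in> coeff_hom K M N" "p \<zero>\<^bsub>M\<^esub> = \<zero>\<^bsub>N\<^esub>" "p ` carrier M = carrier N"
  shows "coeff_object K N"
  using assms by (intro coeff_object_local_image) (force dest: coeff_object_zero, blast)

lemma coeff_hom_zero:
  assumes "coeff_object K M" "coeff_object K N" "f \<in> coeff_hom K M N"
  shows "f \<zero>\<^bsub>M\<^esub> = \<zero>\<^bsub>N\<^esub>"
proof -
  interpret M: abelian_group M using assms(1) by (rule coeff_object_abelian_group)
  interpret N: abelian_group N using assms(2) by (rule coeff_object_abelian_group)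
  have "f \<zero>\<^bsub>M\<^esub> \<oplus>\<^bsub>N\<^esub> f \<zero>\<^bsub>M\<^esub> = f \<zero>\<^bsub>M\<^esub> \<oplus>\<^bsub>N\<^esub> \<zero>\<^bsub>N\<^esub>"
    using coeff_homD(1,2)[OF assms(3)] by (metis M.l_zero M.zero_closed N.r_zero)
  then show ?thesis using coeff_homD(1)[OF assms(3)] by simp
qed

lemma coeff_hom_minus:
  assumes "coeff_object K M" "coeff_object K N" "f \<in> coeff_hom K M N" "x \<in> carrier M"
  shows "f (\<ominus>\<^bsub>M\<^esub> x) = \<ominus>\<^bsub>N\<^esub> f x"
proof -
  interpret M: abelian_group M using assms(1) by (rule coeff_object_abelian_group)
  interpret N: abelian_group N using assms(2) by (rule coeff_object_abelian_group)
  have "f (\<ominus>\<^bsub>M\<^esub> x) \<oplus>\<^bsub>N\<^esub> f x = \<zero>\<^bsub>N\<^esub>"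
    using coeff_homD(2)[OF assms(3), of "\<ominus>\<^bsub>M\<^esub> x" x] coeff_hom_zero[OF assms(1-3)] assms(4)
    by (simp add: M.l_neg)
  then show ?thesis
    using coeff_homD(1)[OF assms(3)] assms(4) by (simp add: N.minus_equality)
qed

section \<open>Submodules, kernels and images\<close>

definition submod :: "'r ring option \<Rightarrow> ('r, 'a) module \<Rightarrow> 'a set \<Rightarrow> bool" where
  "submod K M H \<longleftrightarrow> H \<subseteq> carrier M \<and> \<zero>\<^bsub>M\<^esub> \<in> H \<and> (\<forall>x\<in>H. \<forall>y\<in>H. x \<oplus>\<^bsub>M\<^esub> y \<in> H) \<and>
     (\<forall>x\<in>H. \<ominus>\<^bsub>M\<^esub> x \<in> H) \<and> (\<forall>r\<in>scalars K. \<forall>x\<in>H. r \<odot>\<^bsub>M\<^esub> x \<in> H)"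

text \<open>The negation clause of \<open>submod\<close> supplies the inverses. It cannot be left to
  a scalar -1, because abelian groups come with an empty set of \<open>scalars\<close>.\<close>

lemma coeff_object_submod:
  assumes M: "coeff_object K M" and H: "submod K M H"
  shows "coeff_object K (M\<lparr>carrier := H\<rparr>)"
proof -
  interpret M: abelian_group M using M by (rule coeff_object_abelian_group)
  have sub: "\<And>x. x \<in> H \<Longrightarrow> x \<in> carrier M" using H by (auto simp: submod_def)
  show ?thesis
  proof (rule coeff_objectI)
    fix x assume "x \<in> carrier (M\<lparr>carrier := H\<rparr>)"
    then show "\<exists>y\<in>carrier (M\<lparr>carrier := H\<rparr>). y \<oplus>\<^bsub>M\<lparr>carrier := H\<rparr>\<^esub> x = \<zero>\<^bsub>M\<lparr>carrier := H\<rparr>\<^esub>"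
      using H sub by (intro bexI[of _ "\<ominus>\<^bsub>M\<^esub> x"]) (auto simp: submod_def M.l_neg)
  next
    fix R assume K: "K = Some R"
    then have "scalars K = carrier R" by (simp add: scalars_def)
    then show "ring R \<and> module_axioms R (M\<lparr>carrier := H\<rparr>)"
      using M H K sub by (auto simp: coeff_object_def submod_def module_axioms_def)
  qed (use H sub in \<open>auto simp: submod_def M.a_ac\<close>)
qed

lemma coeff_object_smult_zero:
  assumes "coeff_object K N" "r \<in> scalars K"
  shows "r \<odot>\<^bsub>N\<^esub> \<zero>\<^bsub>N\<^esub> = \<zero>\<^bsub>N\<^esub>"
proof -
  interpret N: abelian_group N using assms(1) by (rule coeff_object_abelian_group)
  have "r \<odot>\<^bsub>N\<^esub> \<zero>\<^bsub>N\<^esub> \<oplus>\<^bsub>N\<^esub> r \<odot>\<^bsub>N\<^esub> \<zero>\<^bsub>N\<^esub> = r \<odot>\<^bsub>N\<^esub> \<zero>\<^bsub>N\<^esub> \<oplus>\<^bsub>N\<^esub> \<zero>\<^bsub>N\<^esub>"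
    using coeff_object_smult_distr[OF assms, of "\<zero>\<^bsub>N\<^esub>" "\<zero>\<^bsub>N\<^esub>"] coeff_object_smult[OF assms]
    by simp
  then show ?thesis using coeff_object_smult[OF assms] by simp
qed

lemma submod_zero:
  assumes "coeff_object K M"
  shows "submod K M {\<zero>\<^bsub>M\<^esub>}"
proof -
  interpret M: abelian_group M using assms(1) by (rule coeff_object_abelian_group)
  show ?thesis using assms by (simp add: submod_def coeff_object_smult_zero)
qed

lemma submod_kernel:
  assumes "coeff_object K M" "coeff_object K N" "f \<in> coeff_hom K M N"
  shows "submod K M (a_kernel M N f)"
  \<comment> \<open>The kernel is the preimage of the zero submodule, whose closure properties
    amount to 0 + 0 = 0, -0 = 0 and r 0 = 0 in the target.\<close>
  using submod_zero[OF assms(2)] unfolding submod_def a_kernel_def'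
  by (simp add: coeff_object_closed[OF assms(1)] coeff_hom_zero[OF assms]
        coeff_hom_minus[OF assms] coeff_homD[OF assms(3)])

lemma submod_image:
  assumes "coeff_object K M" "coeff_object K N" "f \<in> coeff_hom K M N"
  shows "submod K N (f ` carrier M)"
  unfolding submod_def
proof (intro conjI ballI)
  show "f ` carrier M \<subseteq> carrier N" using coeff_homD(1)[OF assms(3)] by auto
  show "\<zero>\<^bsub>N\<^esub> \<in> f ` carrier M"
    using coeff_hom_zero[OF assms] coeff_object_zero[OF assms(1)] by force
  fix y assume "y \<in> f ` carrier M"
  then obtain x where x: "x \<in> carrier M" "y = f x" by auto
  show "\<ominus>\<^bsub>N\<^esub> y \<in> f ` carrier M"
    using coeff_hom_minus[OF assms x(1)] coeff_object_minus[OF assms(1) x(1)] x(2) by force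
  show "r \<odot>\<^bsub>N\<^esub> y \<in> f ` carrier M" if "r \<in> scalars K" for r
    using coeff_homD(3)[OF assms(3) that x(1)] coeff_object_smult[OF assms(1) that x(1)] x(2) by force
  show "y \<oplus>\<^bsub>N\<^esub> z \<in> f ` carrier M" if "z \<in> f ` carrier M" for z
    using that x coeff_homD(2)[OF assms(3)] coeff_object_add[OF assms(1)] by force
qed

text \<open>Negation in the record with carrier \<open>H\<close> is an inverse sought within
  \<open>H\<close>, a priori another operation than negation in \<open>M\<close>. The two agree on
  \<open>N\<close> because inverses are unique.\<close>

lemma submod_restrict:
  assumes "coeff_object K M" "submod K M H" "submod K M N" "N \<subseteq> H"
  shows "submod K (M\<lparr>carrier := H\<rparr>) N"
proof -
  interpret M: abelian_group M using assms(1) by (rule coeff_object_abelian_group)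
  interpret H: abelian_group "M\<lparr>carrier := H\<rparr>"
    using coeff_object_submod[OF assms(1,2)] by (rule coeff_object_abelian_group)
  have "\<ominus>\<^bsub>M\<lparr>carrier := H\<rparr>\<^esub> x = \<ominus>\<^bsub>M\<^esub> x" if "x \<in> N" for x
  proof (rule H.minus_equality)
    show "\<ominus>\<^bsub>M\<^esub> x \<oplus>\<^bsub>M\<lparr>carrier := H\<rparr>\<^esub> x = \<zero>\<^bsub>M\<lparr>carrier := H\<rparr>\<^esub>"
      using that assms(3) by (auto simp: submod_def M.l_neg subset_iff)
  qed (use that assms in \<open>auto simp: submod_def\<close>)
  then show ?thesis using assms by (auto simp: submod_def)
qed

subsection \<open>Quotients\<close>

lemma submod_abelian_subgroup:
  assumes "coeff_object K M" "submod K M H"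
  shows "abelian_subgroup H M"
proof -
  interpret M: abelian_group M using assms(1) by (rule coeff_object_abelian_group)
  have "subgroup H (add_monoid M)"
    using assms(2) by unfold_locales (auto simp: submod_def a_inv_def)
  then show ?thesis
    by (metis abelian_subgroupI3 additive_subgroup.intro M.abelian_group_axioms)
qed

lemma rcos_eq_iff:
  assumes "coeff_object K M" "submod K M H" "x \<in> carrier M" "y \<in> carrier M"
  shows "H +>\<^bsub>M\<^esub> x = H +>\<^bsub>M\<^esub> y \<longleftrightarrow> x \<oplus>\<^bsub>M\<^esub> \<ominus>\<^bsub>M\<^esub> y \<in> H"
proof -
  interpret abelian_subgroup H M using assms(1,2) by (rule submod_abelian_subgroup)
  show ?thesis
    using assms(3,4) a_rcos_module a_rcos_self a_repr_independence a_subgroup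
    by metis
qed

lemma rcos_eq_zero_iff:
  assumes "coeff_object K M" "submod K M H" "x \<in> carrier M"
  shows "H +>\<^bsub>M\<^esub> x = H \<longleftrightarrow> x \<in> H"
proof -
  interpret abelian_subgroup H M using assms(1,2) by (rule submod_abelian_subgroup)
  show ?thesis using assms(3) a_coset_join1 a_coset_join2 a_subgroup by metis
qed

lemma rcos_self:
  assumes "coeff_object K M" "submod K M H" "x \<in> carrier M"
  shows "x \<in> H +>\<^bsub>M\<^esub> x"
  using abelian_subgroup.a_rcos_self[OF submod_abelian_subgroup[OF assms(1,2)] assms(3)] .

lemma rcos_memD:
  assumes "coeff_object K M" "submod K M H" "x \<in> carrier M" "y \<in> H +>\<^bsub>M\<^esub> x"
  shows "y \<in> carrier M" "H +>\<^bsub>M\<^esub> y = H +>\<^bsub>M\<^esub> x"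
proof -
  interpret abelian_subgroup H M using assms(1,2) by (rule submod_abelian_subgroup)
  show "y \<in> carrier M" using a_r_coset_subset_G[OF a_subset assms(3)] assms(4) by auto
  show "H +>\<^bsub>M\<^esub> y = H +>\<^bsub>M\<^esub> x" using a_repr_independence[OF assms(4,3) a_subgroup] by simp
qed

lemma carrier_quot_module: "carrier (quot_module M H) = (\<lambda>x. H +>\<^bsub>M\<^esub> x) ` carrier M"
  by (auto simp: quot_module_def A_RCOSETS_def')

lemma zero_quot_module [simp]: "\<zero>\<^bsub>quot_module M H\<^esub> = H"
  by (simp add: quot_module_def)

text \<open>For y in the coset of x, f y - f x = f (y - x) lies in \<open>L\<close>. Hence the union
  in \<open>quot_map\<close> runs over copies of one coset, and the map may be evaluated on a
  representative.\<close>

lemma quot_map_rcos: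
  assumes M: "coeff_object K M" "submod K M H" and N: "coeff_object K N" "submod K N L"
    and f: "f \<in> coeff_hom K M N" "f ` H \<subseteq> L" and x: "x \<in> carrier M"
  shows "quot_map N L f (H +>\<^bsub>M\<^esub> x) = L +>\<^bsub>N\<^esub> f x"
proof -
  have "L +>\<^bsub>N\<^esub> f y = L +>\<^bsub>N\<^esub> f x" if "y \<in> H +>\<^bsub>M\<^esub> x" for y
  proof -
    note y = rcos_memD[OF M x that]
    have "f (y \<oplus>\<^bsub>M\<^esub> \<ominus>\<^bsub>M\<^esub> x) \<in> L" using y rcos_eq_iff[OF M y(1) x] f(2) by auto
    then have "f y \<oplus>\<^bsub>N\<^esub> \<ominus>\<^bsub>N\<^esub> f x \<in> L"
      using y(1) x by (simp add: coeff_homD[OF f(1)] coeff_object_minus[OF M(1)]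
          coeff_hom_minus[OF M(1) N(1) f(1)])
    then show ?thesis using rcos_eq_iff[OF N] coeff_homD(1)[OF f(1)] y(1) x by simp
  qed
  then show ?thesis unfolding quot_map_def by (intro UN_constant_eq[OF rcos_self[OF M x]] ballI)
qed

lemma smult_quot_module:
  assumes "coeff_object K M" "submod K M H" "r \<in> scalars K" "x \<in> carrier M"
  shows "r \<odot>\<^bsub>quot_module M H\<^esub> (H +>\<^bsub>M\<^esub> x) = H +>\<^bsub>M\<^esub> (r \<odot>\<^bsub>M\<^esub> x)"
proof -
  have "H +>\<^bsub>M\<^esub> r \<odot>\<^bsub>M\<^esub> y = H +>\<^bsub>M\<^esub> r \<odot>\<^bsub>M\<^esub> x" if "y \<in> H +>\<^bsub>M\<^esub> x" for y
  proof -
    interpret M: abelian_group M using assms(1) by (rule coeff_object_abelian_group)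
    note y = rcos_memD[OF assms(1,2,4) that]
    have rx: "r \<odot>\<^bsub>M\<^esub> x \<in> carrier M" "r \<odot>\<^bsub>M\<^esub> y \<in> carrier M"
      using y(1) assms(3,4) by (auto intro: coeff_object_smult[OF assms(1)])
    have "y \<oplus>\<^bsub>M\<^esub> \<ominus>\<^bsub>M\<^esub> x \<in> H" using y rcos_eq_iff[OF assms(1,2) y(1) assms(4)] by auto
    then have "r \<odot>\<^bsub>M\<^esub> (y \<oplus>\<^bsub>M\<^esub> \<ominus>\<^bsub>M\<^esub> x) \<in> H" using assms(2,3) by (auto simp: submod_def)
    \<comment> \<open>Distributivity turns r (-x) + r x into r 0 = 0, so r (-x) is the negative of r
      x.\<close>
    moreover have "r \<odot>\<^bsub>M\<^esub> (\<ominus>\<^bsub>M\<^esub> x) = \<ominus>\<^bsub>M\<^esub> (r \<odot>\<^bsub>M\<^esub> x)"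
    proof (rule M.minus_equality[symmetric])
      have "r \<odot>\<^bsub>M\<^esub> (\<ominus>\<^bsub>M\<^esub> x) \<oplus>\<^bsub>M\<^esub> r \<odot>\<^bsub>M\<^esub> x = r \<odot>\<^bsub>M\<^esub> (\<ominus>\<^bsub>M\<^esub> x \<oplus>\<^bsub>M\<^esub> x)"
        using coeff_object_smult_distr[OF assms(1,3)] assms(4) by simp
      then show "r \<odot>\<^bsub>M\<^esub> (\<ominus>\<^bsub>M\<^esub> x) \<oplus>\<^bsub>M\<^esub> r \<odot>\<^bsub>M\<^esub> x = \<zero>\<^bsub>M\<^esub>"
        using coeff_object_smult_zero[OF assms(1,3)] assms(4) by (simp add: M.l_neg)
    qed (use assms(4) rx coeff_object_smult[OF assms(1,3)] in auto)
    ultimately show ?thesis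
      using rcos_eq_iff[OF assms(1,2) rx(2,1)] assms y(1) by (simp add: coeff_object_smult_distr)
  qed
  then have "(\<Union>y\<in>H +>\<^bsub>M\<^esub> x. H +>\<^bsub>M\<^esub> r \<odot>\<^bsub>M\<^esub> y) = H +>\<^bsub>M\<^esub> r \<odot>\<^bsub>M\<^esub> x"
    by (intro UN_constant_eq[OF rcos_self[OF assms(1,2,4)]] ballI)
  then show ?thesis by (simp add: quot_module_def)
qed

lemma rcos_coeff_hom:
  assumes "coeff_object K M" "submod K M H"
  shows "(\<lambda>x. H +>\<^bsub>M\<^esub> x) \<in> coeff_hom K M (quot_module M H)"
proof (rule coeff_homI)
  interpret abelian_subgroup H M using assms by (rule submod_abelian_subgroup)
  show "H +>\<^bsub>M\<^esub> (x \<oplus>\<^bsub>M\<^esub> y) = (H +>\<^bsub>M\<^esub> x) \<oplus>\<^bsub>quot_module M H\<^esub> (H +>\<^bsub>M\<^esub> y)"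
    if "x \<in> carrier M" "y \<in> carrier M" for x y
    using that by (simp add: quot_module_def a_rcos_sum)
qed (use assms in \<open>auto simp: carrier_quot_module smult_quot_module\<close>)

lemma rcos_zero:
  assumes "coeff_object K M" "submod K M H"
  shows "H +>\<^bsub>M\<^esub> \<zero>\<^bsub>M\<^esub> = H"
  using assms by (subst rcos_eq_zero_iff) (auto simp: submod_def)

lemma coeff_object_quot_module:
  assumes "coeff_object K M" "submod K M H"
  shows "coeff_object K (quot_module M H)"
  using assms by (intro coeff_object_image[OF assms(1) rcos_coeff_hom[OF assms]])
    (auto simp: carrier_quot_module rcos_zero)

text \<open>Counterpart of \<open>coeff_object_local_image\<close> for maps out of \<open>N\<close>:
  additivity and linearity concern at most two elements, so they may be checked after pulling back
  along a homomorphism whose image contains both. On a stalk, the sections over one small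
  neighbourhood serve for this.\<close>

lemma coeff_hom_local_factor:
  assumes "\<And>x y. x \<in> carrier N \<Longrightarrow> y \<in> carrier N \<Longrightarrow>
      \<exists>(M :: ('r, 'b) module) p. coeff_object K M \<and> p \<in> coeff_hom K M N \<and>
        (\<lambda>a. f (p a)) \<in> coeff_hom K M L \<and> {x, y} \<subseteq> p ` carrier M"
  shows "f \<in> coeff_hom K N L"
proof (rule coeff_homI)
  fix x y assume xy: "x \<in> carrier N" "y \<in> carrier N"
  from assms[OF this] obtain M :: "('r, 'b) module" and p a b
    where *: "coeff_object K M" "p \<in> coeff_hom K M N" "(\<lambda>a. f (p a)) \<in> coeff_hom K M L"
      "a \<in> carrier M" "b \<in> carrier M" "x = p a" "y = p b" by auto
  show "f x \<in> carrier L" using * coeff_homD(1)[OF *(3)] by auto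
  show "f (x \<oplus>\<^bsub>N\<^esub> y) = f x \<oplus>\<^bsub>L\<^esub> f y"
    using * coeff_homD(2)[OF *(3), of a b] by (simp add: coeff_homD(2)[OF *(2)])
  show "f (r \<odot>\<^bsub>N\<^esub> x) = r \<odot>\<^bsub>L\<^esub> f x" if "r \<in> scalars K" for r
    using * that coeff_homD(3)[OF *(3), of r a] by (simp add: coeff_homD(3)[OF *(2)])
qed

lemma coeff_hom_factor:
  assumes "coeff_object K M" "p \<in> coeff_hom K M N" "carrier N = p ` carrier M"
    "(\<lambda>a. f (p a)) \<in> coeff_hom K M L"
  shows "f \<in> coeff_hom K N L"
  using assms by (intro coeff_hom_local_factor) blast

text \<open>The two maps agree on the carrier alone, so closure of \<open>M\<close> is what allows
  them to be compared at sums and multiples.\<close>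

lemma coeff_hom_cong:
  assumes "coeff_object K M" "\<And>x. x \<in> carrier M \<Longrightarrow> f x = g x" "g \<in> coeff_hom K M N"
  shows "f \<in> coeff_hom K M N"
  using assms(2,3) by (simp add: coeff_hom_iff coeff_object_closed[OF assms(1)])

lemma quot_map_coeff_hom:
  assumes M: "coeff_object K M" "submod K M H" and N: "coeff_object K N" "submod K N L"
    and f: "f \<in> coeff_hom K M N" "f ` H \<subseteq> L"
  shows "quot_map N L f \<in> coeff_hom K (quot_module M H) (quot_module N L)"
proof (rule coeff_hom_factor[OF M(1) rcos_coeff_hom[OF M] carrier_quot_module])
  show "(\<lambda>a. quot_map N L f (H +>\<^bsub>M\<^esub> a)) \<in> coeff_hom K M (quot_module N L)"
    by (rule coeff_hom_cong[OF M(1) _ coeff_hom_comp[OF f(1) rcos_coeff_hom[OF N]]])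
      (simp add: quot_map_rcos[OF M N f])
qed

section \<open>Presheaves, stalks and sheafification\<close>

lemma presheaf_sec: "presheaf K X F \<Longrightarrow> openin X U \<Longrightarrow> coeff_object K (sec F U)"
  by (simp add: presheaf_def)

lemma presheaf_restr_hom:
  "presheaf K X F \<Longrightarrow> openin X U \<Longrightarrow> openin X V \<Longrightarrow> V \<subseteq> U \<Longrightarrow>
     restr F U V \<in> coeff_hom K (sec F U) (sec F V)"
  by (simp add: presheaf_def)

lemma presheaf_restr_id:
  "presheaf K X F \<Longrightarrow> openin X U \<Longrightarrow> s \<in> carrier (sec F U) \<Longrightarrow> restr F U U s = s"
  by (simp add: presheaf_def)

lemma presheaf_restr_comp:
  "presheaf K X F \<Longrightarrow> openin X U \<Longrightarrow> openin X V \<Longrightarrow> openin X W \<Longrightarrow> W \<subseteq> V \<Longrightarrow> V \<subseteq> U \<Longrightarrow>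
     s \<in> carrier (sec F U) \<Longrightarrow> restr F V W (restr F U V s) = restr F U W s"
  by (simp add: presheaf_def)

lemma presheaf_restr_closed:
  "presheaf K X F \<Longrightarrow> openin X U \<Longrightarrow> openin X V \<Longrightarrow> V \<subseteq> U \<Longrightarrow> s \<in> carrier (sec F U) \<Longrightarrow>
     restr F U V s \<in> carrier (sec F V)"
  using presheaf_restr_hom coeff_homD(1) by fast

lemma sheaf_morphism_hom:
  "sheaf_morphism K X F G \<phi> \<Longrightarrow> openin X U \<Longrightarrow> \<phi> U \<in> coeff_hom K (sec F U) (sec G U)"
  by (simp add: sheaf_morphism_def)

lemma sheaf_morphism_restr:
  "sheaf_morphism K X F G \<phi> \<Longrightarrow> openin X U \<Longrightarrow> openin X V \<Longrightarrow> V \<subseteq> U \<Longrightarrow> s \<in> carrier (sec F U) \<Longrightarrow>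
     \<phi> V (restr F U V s) = restr G U V (\<phi> U s)"
  by (simp add: sheaf_morphism_def)

subsection \<open>Germs\<close>

text \<open>The content is transitivity: agreement on \<open>A\<close> and agreement on
  \<open>B\<close> both persist on the intersection, which still contains \<open>y\<close>.\<close>

lemma equiv_germ_rel:
  assumes F: "presheaf K X F"
  shows "equiv {(U, s). openin X U \<and> y \<in> U \<and> s \<in> carrier (sec F U)} (germ_rel X F y)"
    (is "equiv ?A _")
proof (rule equivI)
  show "germ_rel X F y \<subseteq> ?A \<times> ?A" by (auto simp: germ_rel_def)
  show "refl_on ?A (germ_rel X F y)" by (auto simp: refl_on_def germ_rel_def)
  show "sym (germ_rel X F y)" by (rule symI) (auto simp: germ_rel_def; metis)
  show "trans (germ_rel X F y)"
  proof (rule transI, clarsimp simp: germ_rel_def)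
    fix U s V t W u A B
    assume *: "openin X U" "openin X V" "openin X W" "openin X A" "openin X B"
      "s \<in> carrier (sec F U)" "t \<in> carrier (sec F V)" "u \<in> carrier (sec F W)"
      "y \<in> A" "y \<in> B" "A \<subseteq> U" "A \<subseteq> V" "B \<subseteq> V" "B \<subseteq> W"
      "restr F U A s = restr F V A t" "restr F V B t = restr F W B u"
    have "openin X (A \<inter> B)" using * by auto
    then have "restr F U (A \<inter> B) s = restr F V (A \<inter> B) t" "restr F V (A \<inter> B) t = restr F W (A \<inter> B) u"
      using * presheaf_restr_comp[OF F, of U A "A \<inter> B" s] presheaf_restr_comp[OF F, of V A "A \<inter> B" t]
        presheaf_restr_comp[OF F, of V B "A \<inter> B" t] presheaf_restr_comp[OF F, of W B "A \<inter> B" u]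
      by auto
    then show "\<exists>C. openin X C \<and> y \<in> C \<and> C \<subseteq> U \<and> C \<subseteq> W \<and> restr F U C s = restr F W C u"
      using * by (intro exI[of _ "A \<inter> B"]) auto
  qed
qed

lemma germ_eq_iff:
  assumes F: "presheaf K X F" and "openin X U" "y \<in> U" "s \<in> carrier (sec F U)"
    "openin X V" "y \<in> V" "t \<in> carrier (sec F V)"
  shows "germ X F y U s = germ X F y V t \<longleftrightarrow>
    (\<exists>W. openin X W \<and> y \<in> W \<and> W \<subseteq> U \<inter> V \<and> restr F U W s = restr F V W t)"
  unfolding germ_def
  by (subst eq_equiv_class_iff[OF equiv_germ_rel[OF F]]) (use assms in \<open>auto simp: germ_rel_def\<close>)

lemma germ_self:
  assumes "presheaf K X F" "openin X U" "y \<in> U" "s \<in> carrier (sec F U)"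
  shows "(U, s) \<in> germ X F y U s"
  unfolding germ_def by (rule equiv_class_self[OF equiv_germ_rel]) (use assms in auto)

lemma germ_memD:
  assumes F: "presheaf K X F" and "(V, t) \<in> germ X F y U s"
  shows "openin X V" "y \<in> V" "t \<in> carrier (sec F V)" "germ X F y V t = germ X F y U s"
proof -
  have r: "((U, s), (V, t)) \<in> germ_rel X F y" using assms(2) by (simp add: germ_def)
  then show "openin X V" "y \<in> V" "t \<in> carrier (sec F V)" by (auto simp: germ_rel_def)
  show "germ X F y V t = germ X F y U s"
    unfolding germ_def using equiv_class_eq[OF equiv_germ_rel[OF F] r] by simp
qed

lemma germ_restr:
  assumes F: "presheaf K X F" and "openin X U" "openin X V" "V \<subseteq> U" "y \<in> V" "s \<in> carrier (sec F U)"
  shows "germ X F y V (restr F U V s) = germ X F y U s"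
  using assms
  by (subst germ_eq_iff[OF F])
    (auto intro!: exI[of _ V] presheaf_restr_closed[OF F] presheaf_restr_id[OF F])

lemma carrier_stalk:
  "carrier (stalk X F y) = {germ X F y U s | U s. openin X U \<and> y \<in> U \<and> s \<in> carrier (sec F U)}"
  by (simp add: stalk_def)

lemma germ_in_stalk:
  "openin X U \<Longrightarrow> y \<in> U \<Longrightarrow> s \<in> carrier (sec F U) \<Longrightarrow> germ X F y U s \<in> carrier (stalk X F y)"
  by (auto simp: carrier_stalk)

lemma stalk_germ_within:
  assumes "presheaf K X F" "x \<in> carrier (stalk X F y)" "openin X W" "y \<in> W"
  obtains V s where "openin X V" "y \<in> V" "V \<subseteq> W" "s \<in> carrier (sec F V)" "x = germ X F y V s"
proof -
  from assms(2) obtain U s where "openin X U" "y \<in> U" "s \<in> carrier (sec F U)" "x = germ X F y U s"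
    by (auto simp: carrier_stalk)
  then show thesis
    using assms that[of "U \<inter> W" "restr F U (U \<inter> W) s"]
    by (auto simp: germ_restr presheaf_restr_closed)
qed

text \<open>The zero of \<open>stalk\<close> is the germ of the zero section over the whole space.
  Restriction is a homomorphism, so zero sections over smaller open sets have the same germ.\<close>

lemma stalk_zero:
  assumes F: "presheaf K X F" and "openin X U" "y \<in> U"
  shows "germ X F y U \<zero>\<^bsub>sec F U\<^esub> = \<zero>\<^bsub>stalk X F y\<^esub>"
proof -
  have U: "U \<subseteq> topspace X" using assms(2) by (rule openin_subset)
  have "restr F (topspace X) U \<zero>\<^bsub>sec F (topspace X)\<^esub> = \<zero>\<^bsub>sec F U\<^esub>"
    using coeff_hom_zero[OF presheaf_sec[OF F] presheaf_sec[OF F] presheaf_restr_hom[OF F]] assms U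
    by auto
  then show ?thesis
    using germ_restr[OF F, of "topspace X" U y "\<zero>\<^bsub>sec F (topspace X)\<^esub>"] assms U
      coeff_object_zero[OF presheaf_sec[OF F]] by (simp add: stalk_def)
qed

text \<open>The operations of \<open>stalk\<close> are unions over all representatives of the germs.
  Any two choices yield sections that coincide on a smaller neighbourhood of \<open>y\<close>, so
  the union collapses to the germ of the sum or multiple over \<open>U\<close>.\<close>

lemma germ_coeff_hom:
  assumes F: "presheaf K X F" and U: "openin X U" "y \<in> U"
  shows "germ X F y U \<in> coeff_hom K (sec F U) (stalk X F y)"
proof (rule coeff_homI)
  fix s assume s: "s \<in> carrier (sec F U)"
  show "germ X F y U s \<in> carrier (stalk X F y)" using U s by (rule germ_in_stalk)
  show "germ X F y U (r \<odot>\<^bsub>sec F U\<^esub> s) = r \<odot>\<^bsub>stalk X F y\<^esub> germ X F y U s"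
    if r: "r \<in> scalars K" for r
  proof -
    have "germ X F y V (r \<odot>\<^bsub>sec F V\<^esub> t) = germ X F y U (r \<odot>\<^bsub>sec F U\<^esub> s)"
      if Vt: "(V, t) \<in> germ X F y U s" for V t
    proof -
      note V = germ_memD[OF F Vt]
      obtain W where W: "openin X W" "y \<in> W" "W \<subseteq> V \<inter> U" "restr F V W t = restr F U W s"
        using V(4) unfolding germ_eq_iff[OF F V(1-3) U s] by blast
      have "restr F V W (r \<odot>\<^bsub>sec F V\<^esub> t) = restr F U W (r \<odot>\<^bsub>sec F U\<^esub> s)"
        using W V(1-3) U s r coeff_homD(3)[OF presheaf_restr_hom[OF F]] by auto
      then show ?thesis
        using W V(1-3) U s r
        by (subst germ_eq_iff[OF F]) (auto intro!: coeff_object_smult[OF presheaf_sec[OF F]])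
    qed
    then have "(\<Union>(V, t)\<in>germ X F y U s. germ X F y V (r \<odot>\<^bsub>sec F V\<^esub> t)) =
        germ X F y U (r \<odot>\<^bsub>sec F U\<^esub> s)"
      by (intro UN_constant_eq[OF germ_self[OF F U s]]) blast
    then show ?thesis by (simp add: stalk_def)
  qed
  fix t assume t: "t \<in> carrier (sec F U)"
  show "germ X F y U (s \<oplus>\<^bsub>sec F U\<^esub> t) = germ X F y U s \<oplus>\<^bsub>stalk X F y\<^esub> germ X F y U t"
  proof -
    have *: "germ X F y (V \<inter> V') (restr F V (V \<inter> V') s' \<oplus>\<^bsub>sec F (V \<inter> V')\<^esub> restr F V' (V \<inter> V') t')
        = germ X F y U (s \<oplus>\<^bsub>sec F U\<^esub> t)"
      if Vs: "(V, s') \<in> germ X F y U s" and Vt: "(V', t') \<in> germ X F y U t" for V V' s' t'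
    proof -
      note V = germ_memD[OF F Vs] and V' = germ_memD[OF F Vt]
      obtain A where A: "openin X A" "y \<in> A" "A \<subseteq> V \<inter> U" "restr F V A s' = restr F U A s"
        using V(4) unfolding germ_eq_iff[OF F V(1-3) U s] by blast
      obtain B where B: "openin X B" "y \<in> B" "B \<subseteq> V' \<inter> U" "restr F V' B t' = restr F U B t"
        using V'(4) unfolding germ_eq_iff[OF F V'(1-3) U t] by blast
      \<comment> \<open>\<open>A\<close> and \<open>B\<close> are where the two representatives
        agree with \<open>s\<close> and with \<open>t\<close>; on the intersection both summands can
        be replaced at once.\<close>
      define W where "W = A \<inter> B"
      have W: "openin X W" "y \<in> W" "W \<subseteq> A" "W \<subseteq> B" "W \<subseteq> V \<inter> V'" "W \<subseteq> U" "W \<subseteq> V" "W \<subseteq> V'"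
        using A B by (auto simp: W_def)
      have VV: "openin X (V \<inter> V')" using V V' by auto
      have s': "restr F V W s' = restr F U W s"
        using presheaf_restr_comp[OF F V(1) A(1) W(1) W(3) _ V(3)]
          presheaf_restr_comp[OF F U(1) A(1) W(1) W(3) _ s] A by auto
      have t': "restr F V' W t' = restr F U W t"
        using presheaf_restr_comp[OF F V'(1) B(1) W(1) W(4) _ V'(3)]
          presheaf_restr_comp[OF F U(1) B(1) W(1) W(4) _ t] B by auto
      have cl: "restr F V (V \<inter> V') s' \<in> carrier (sec F (V \<inter> V'))"
        "restr F V' (V \<inter> V') t' \<in> carrier (sec F (V \<inter> V'))"
        using V V' VV by (auto intro!: presheaf_restr_closed[OF F])
      have "restr F (V \<inter> V') W (restr F V (V \<inter> V') s' \<oplus>\<^bsub>sec F (V \<inter> V')\<^esub> restr F V' (V \<inter> V') t')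
          = restr F V W s' \<oplus>\<^bsub>sec F W\<^esub> restr F V' W t'"
        using cl coeff_homD(2)[OF presheaf_restr_hom[OF F VV W(1,5)]]
          presheaf_restr_comp[OF F V(1) VV W(1,5) _ V(3)]
          presheaf_restr_comp[OF F V'(1) VV W(1,5) _ V'(3)] by simp
      also have "\<dots> = restr F U W (s \<oplus>\<^bsub>sec F U\<^esub> t)"
        using s t s' t' coeff_homD(2)[OF presheaf_restr_hom[OF F U(1) W(1,6)]] by simp
      finally show ?thesis
        using W U V V' VV s t cl
        by (subst germ_eq_iff[OF F]) (auto intro!: coeff_object_add[OF presheaf_sec[OF F]])
    qed
    have "(\<Union>(V, s')\<in>germ X F y U s. \<Union>(V', t')\<in>germ X F y U t. germ X F y (V \<inter> V')
          (restr F V (V \<inter> V') s' \<oplus>\<^bsub>sec F (V \<inter> V')\<^esub> restr F V' (V \<inter> V') t')) =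
        germ X F y U (s \<oplus>\<^bsub>sec F U\<^esub> t)"
    proof (rule UN_constant_eq[OF germ_self[OF F U s]], clarify)
      fix V s' assume Vs: "(V, s') \<in> germ X F y U s"
      show "(\<Union>(V', t')\<in>germ X F y U t. germ X F y (V \<inter> V')
          (restr F V (V \<inter> V') s' \<oplus>\<^bsub>sec F (V \<inter> V')\<^esub> restr F V' (V \<inter> V') t')) =
        germ X F y U (s \<oplus>\<^bsub>sec F U\<^esub> t)"
        by (rule UN_constant_eq[OF germ_self[OF F U t]]) (use *[OF Vs] in blast)
    qed
    then show ?thesis by (simp add: stalk_def)
  qed
qed

text \<open>A stalk is a directed limit: one more germ only shrinks the neighbourhood, and the
  earlier representatives restrict to it. Finitely many germs over one \<open>U\<close> are what the
  local criteria ask for, three elements for objects and two for homomorphisms.\<close>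

lemma stalk_common_germs:
  assumes F: "presheaf K X F" and "finite A" "A \<subseteq> carrier (stalk X F y)" "y \<in> topspace X"
  shows "\<exists>U. openin X U \<and> y \<in> U \<and> A \<subseteq> germ X F y U ` carrier (sec F U)"
  using assms(2,3)
proof (induction A)
  case empty
  then show ?case using assms(4) by blast
next
  case (insert x A)
  then obtain U where U: "openin X U" "y \<in> U" "A \<subseteq> germ X F y U ` carrier (sec F U)" by auto
  have "x \<in> carrier (stalk X F y)" using insert.prems by simp
  then obtain V s where V: "openin X V" "y \<in> V" "V \<subseteq> U" "s \<in> carrier (sec F V)" "x = germ X F y V s"
    using stalk_germ_within[OF F _ U(1,2)] by metis
  have "a \<in> germ X F y V ` carrier (sec F V)" if a: "a \<in> A" for a
  proof -
    obtain t where "t \<in> carrier (sec F U)" "a = germ X F y U t" using a U(3) by blast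
    then show ?thesis
      using germ_restr[OF F U(1) V(1,3,2)] presheaf_restr_closed[OF F U(1) V(1,3)] by force
  qed
  then show ?case using V by blast
qed

lemma coeff_object_stalk:
  fixes F :: "('p, 'r, 'a) presheaf"
  assumes F: "presheaf K X F" and y: "y \<in> topspace X"
  shows "coeff_object K (stalk X F y)"
proof (rule coeff_object_local_image)
  show "\<zero>\<^bsub>stalk X F y\<^esub> \<in> carrier (stalk X F y)"
    using germ_in_stalk[of X "topspace X" y "\<zero>\<^bsub>sec F (topspace X)\<^esub>" F] y
      coeff_object_zero[OF presheaf_sec[OF F]] by (simp add: stalk_zero[OF F])
next
  fix a b c
  assume "a \<in> carrier (stalk X F y)" "b \<in> carrier (stalk X F y)" "c \<in> carrier (stalk X F y)"
  then obtain U where "openin X U" "y \<in> U" "{a, b, c} \<subseteq> germ X F y U ` carrier (sec F U)"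
    using stalk_common_germs[OF F, of "{a, b, c}" y] y by auto
  then show "\<exists>(M :: ('r, 'a) module) p. coeff_object K M \<and> p \<in> coeff_hom K M (stalk X F y) \<and> p \<zero>\<^bsub>M\<^esub> = \<zero>\<^bsub>stalk X F y\<^esub> \<and>
      {a, b, c} \<subseteq> p ` carrier M"
    using presheaf_sec[OF F] germ_coeff_hom[OF F] stalk_zero[OF F]
    by (intro exI[of _ "sec F U"] exI[of _ "germ X F y U"]) simp
qed

text \<open>\<open>\<phi>\<close> commutes with restriction, so representatives that agree on
  \<open>W\<close> have images that agree on \<open>W\<close>, and the union defining
  \<open>stalk_map\<close> is a single germ.\<close>

lemma stalk_map_germ:
  assumes F: "presheaf K X F" and G: "presheaf K X G" and \<phi>: "sheaf_morphism K X F G \<phi>"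
    and U: "openin X U" "y \<in> U" and s: "s \<in> carrier (sec F U)"
  shows "stalk_map X G \<phi> y (germ X F y U s) = germ X G y U (\<phi> U s)"
proof -
  have "germ X G y V (\<phi> V t) = germ X G y U (\<phi> U s)" if Vt: "(V, t) \<in> germ X F y U s" for V t
  proof -
    note V = germ_memD[OF F Vt]
    obtain W where W: "openin X W" "y \<in> W" "W \<subseteq> V \<inter> U" "restr F V W t = restr F U W s"
      using V(4) unfolding germ_eq_iff[OF F V(1-3) U s] by blast
    have "restr G V W (\<phi> V t) = restr G U W (\<phi> U s)"
      using W V(1-3) U s sheaf_morphism_restr[OF \<phi>, of V W t] sheaf_morphism_restr[OF \<phi>, of U W s]
      by simp
    then show ?thesis
      using W V(1-3) U s
      by (subst germ_eq_iff[OF G]) (auto intro!: coeff_homD(1)[OF sheaf_morphism_hom[OF \<phi>]])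
  qed
  then show ?thesis
    unfolding stalk_map_def by (intro UN_constant_eq[OF germ_self[OF F U s]]) blast
qed

lemma stalk_map_coeff_hom:
  fixes F :: "('p, 'r, 'a) presheaf"
  assumes F: "presheaf K X F" and G: "presheaf K X G" and \<phi>: "sheaf_morphism K X F G \<phi>"
    and y: "y \<in> topspace X"
  shows "stalk_map X G \<phi> y \<in> coeff_hom K (stalk X F y) (stalk X G y)"
proof (rule coeff_hom_local_factor)
  fix a b assume "a \<in> carrier (stalk X F y)" "b \<in> carrier (stalk X F y)"
  then obtain U where U: "openin X U" "y \<in> U" "{a, b} \<subseteq> germ X F y U ` carrier (sec F U)"
    using stalk_common_germs[OF F, of "{a, b}" y] y by auto
  have "(\<lambda>s. stalk_map X G \<phi> y (germ X F y U s)) \<in> coeff_hom K (sec F U) (stalk X G y)"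
    by (rule coeff_hom_cong[OF presheaf_sec[OF F U(1)] _
          coeff_hom_comp[OF sheaf_morphism_hom[OF \<phi> U(1)] germ_coeff_hom[OF G U(1,2)]]])
      (simp add: stalk_map_germ[OF F G \<phi> U(1,2)])
  then show "\<exists>(M :: ('r, 'a) module) p. coeff_object K M \<and> p \<in> coeff_hom K M (stalk X F y) \<and>
      (\<lambda>s. stalk_map X G \<phi> y (p s)) \<in> coeff_hom K M (stalk X G y) \<and> {a, b} \<subseteq> p ` carrier M"
    using U presheaf_sec[OF F U(1)] germ_coeff_hom[OF F U(1,2)]
    by (intro exI[of _ "sec F U"] exI[of _ "germ X F y U"]) simp
qed

subsection \<open>Families of germs\<close>

lemma C0_simps [simp]:
  "carrier (sec (C0 X F) U) = (\<Pi>\<^sub>E y\<in>U. carrier (stalk X F y))"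
  "\<sigma> \<oplus>\<^bsub>sec (C0 X F) U\<^esub> \<tau> = (\<lambda>y\<in>U. \<sigma> y \<oplus>\<^bsub>stalk X F y\<^esub> \<tau> y)"
  "\<zero>\<^bsub>sec (C0 X F) U\<^esub> = (\<lambda>y\<in>U. \<zero>\<^bsub>stalk X F y\<^esub>)"
  "r \<odot>\<^bsub>sec (C0 X F) U\<^esub> \<sigma> = (\<lambda>y\<in>U. r \<odot>\<^bsub>stalk X F y\<^esub> \<sigma> y)"
  "restr (C0 X F) U V \<sigma> = restrict \<sigma> V"
  by (simp_all add: C0_def)

lemma coeff_object_C0:
  assumes F: "presheaf K X F" and U: "U \<subseteq> topspace X"
  shows "coeff_object K (sec (C0 X F) U)"
proof -
  have st: "coeff_object K (stalk X F y)" if "y \<in> U" for y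
    using coeff_object_stalk[OF F] that U by auto
  note ab = coeff_object_abelian_group[OF st]
  note mon = abelian_group.axioms(1)[OF ab]
  have mem: "\<sigma> y \<in> carrier (stalk X F y)" if "\<sigma> \<in> (\<Pi>\<^sub>E y\<in>U. carrier (stalk X F y))" "y \<in> U" for \<sigma> y
    using that by auto
  show ?thesis
  proof (rule coeff_objectI)
    fix \<sigma> assume \<sigma>: "\<sigma> \<in> carrier (sec (C0 X F) U)"
    show "\<exists>\<tau>\<in>carrier (sec (C0 X F) U). \<tau> \<oplus>\<^bsub>sec (C0 X F) U\<^esub> \<sigma> = \<zero>\<^bsub>sec (C0 X F) U\<^esub>"
      using \<sigma>
      by (intro bexI[of _ "\<lambda>y\<in>U. \<ominus>\<^bsub>stalk X F y\<^esub> \<sigma> y"])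
        (simp_all add: restrict_PiE_iff coeff_object_minus[OF st mem] abelian_group.l_neg[OF ab mem]
          cong: restrict_cong)
    show "\<zero>\<^bsub>sec (C0 X F) U\<^esub> \<oplus>\<^bsub>sec (C0 X F) U\<^esub> \<sigma> = \<sigma>"
      using \<sigma> by (intro extensionalityI[of _ U])
        (auto simp: abelian_monoid.l_zero[OF mon mem] PiE_def)
  next
    fix \<sigma> \<tau> \<rho>
    assume *: "\<sigma> \<in> carrier (sec (C0 X F) U)" "\<tau> \<in> carrier (sec (C0 X F) U)"
      "\<rho> \<in> carrier (sec (C0 X F) U)"
    then show "(\<sigma> \<oplus>\<^bsub>sec (C0 X F) U\<^esub> \<tau>) \<oplus>\<^bsub>sec (C0 X F) U\<^esub> \<rho> =
        \<sigma> \<oplus>\<^bsub>sec (C0 X F) U\<^esub> (\<tau> \<oplus>\<^bsub>sec (C0 X F) U\<^esub> \<rho>)"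
      by (auto intro!: restrict_ext simp: abelian_monoid.a_assoc[OF mon mem mem mem])
  next
    fix \<sigma> \<tau>
    assume *: "\<sigma> \<in> carrier (sec (C0 X F) U)" "\<tau> \<in> carrier (sec (C0 X F) U)"
    then show "\<sigma> \<oplus>\<^bsub>sec (C0 X F) U\<^esub> \<tau> = \<tau> \<oplus>\<^bsub>sec (C0 X F) U\<^esub> \<sigma>"
      by (auto intro!: restrict_ext simp: abelian_monoid.a_comm[OF mon mem mem])
    show "\<sigma> \<oplus>\<^bsub>sec (C0 X F) U\<^esub> \<tau> \<in> carrier (sec (C0 X F) U)"
      using * by (simp add: restrict_PiE_iff coeff_object_add[OF st mem mem])
  next
    show "\<zero>\<^bsub>sec (C0 X F) U\<^esub> \<in> carrier (sec (C0 X F) U)"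
      by (simp add: restrict_PiE_iff coeff_object_zero[OF st])
  next
    fix R assume K: "K = Some R"
    \<comment> \<open>\<open>U\<close> may be empty, and then it has no stalk to consult; the ring
      axioms are read off from the module of global sections.\<close>
    have R: "ring R"
      using presheaf_sec[OF F, of "topspace X"] K by (simp add: coeff_object_def)
    have m: "module_axioms R (stalk X F y)" if "y \<in> U" for y
      using st[OF that] K by (simp add: coeff_object_def)
    have ax: "r \<in> carrier R \<Longrightarrow> a \<in> carrier (stalk X F y) \<Longrightarrow>
          r \<odot>\<^bsub>stalk X F y\<^esub> a \<in> carrier (stalk X F y)"
        "r \<in> carrier R \<Longrightarrow> r' \<in> carrier R \<Longrightarrow> a \<in> carrier (stalk X F y) \<Longrightarrow>
          (r \<oplus>\<^bsub>R\<^esub> r') \<odot>\<^bsub>stalk X F y\<^esub> a = r \<odot>\<^bsub>stalk X F y\<^esub> a \<oplus>\<^bsub>stalk X F y\<^esub> r' \<odot>\<^bsub>stalk X F y\<^esub> a"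
        "r \<in> carrier R \<Longrightarrow> a \<in> carrier (stalk X F y) \<Longrightarrow> b \<in> carrier (stalk X F y) \<Longrightarrow>
          r \<odot>\<^bsub>stalk X F y\<^esub> (a \<oplus>\<^bsub>stalk X F y\<^esub> b) =
            r \<odot>\<^bsub>stalk X F y\<^esub> a \<oplus>\<^bsub>stalk X F y\<^esub> r \<odot>\<^bsub>stalk X F y\<^esub> b"
        "r \<in> carrier R \<Longrightarrow> r' \<in> carrier R \<Longrightarrow> a \<in> carrier (stalk X F y) \<Longrightarrow>
          (r \<otimes>\<^bsub>R\<^esub> r') \<odot>\<^bsub>stalk X F y\<^esub> a = r \<odot>\<^bsub>stalk X F y\<^esub> (r' \<odot>\<^bsub>stalk X F y\<^esub> a)"
        "a \<in> carrier (stalk X F y) \<Longrightarrow> \<one>\<^bsub>R\<^esub> \<odot>\<^bsub>stalk X F y\<^esub> a = a"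
      if y: "y \<in> U" for y r r' a b
      using m[OF y] by (simp_all add: module_axioms_def)
    have "module_axioms R (sec (C0 X F) U)"
    proof
      fix \<sigma> assume \<sigma>: "\<sigma> \<in> carrier (sec (C0 X F) U)"
      show "\<one>\<^bsub>R\<^esub> \<odot>\<^bsub>sec (C0 X F) U\<^esub> \<sigma> = \<sigma>"
        using \<sigma> by (intro extensionalityI[of _ U]) (auto simp: PiE_def ax(5)[OF _ mem])
    qed (simp_all add: restrict_PiE_iff mem ax cong: restrict_cong)
    with R show "ring R \<and> module_axioms R (sec (C0 X F) U)" ..
  qed
qed

lemma presheaf_C0:
  assumes F: "presheaf K X F"
  shows "presheaf K X (C0 X F)"
  unfolding presheaf_def
proof (intro conjI allI impI ballI)
  fix U assume U: "openin X U"
  then have U': "U \<subseteq> topspace X" by (rule openin_subset)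
  show "coeff_object K (sec (C0 X F) U)" by (rule coeff_object_C0[OF F U'])
  show "restr (C0 X F) U U \<sigma> = \<sigma>" if "\<sigma> \<in> carrier (sec (C0 X F) U)" for \<sigma>
    using that by (auto simp: PiE_def extensional_restrict)
  fix V assume V: "openin X V" "V \<subseteq> U"
  show "restr (C0 X F) U V \<in> coeff_hom K (sec (C0 X F) U) (sec (C0 X F) V)"
  proof (rule coeff_homI)
    show "restr (C0 X F) U V \<sigma> \<in> carrier (sec (C0 X F) V)" if "\<sigma> \<in> carrier (sec (C0 X F) U)" for \<sigma>
      using that V(2) by auto
  qed (use V in \<open>auto simp: fun_eq_iff restrict_def\<close>)
qed (auto simp: Int_absorb1)

lemma C0_unit_coeff_hom:
  assumes F: "presheaf K X F" and U: "openin X U"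
  shows "C0_unit X F U \<in> coeff_hom K (sec F U) (sec (C0 X F) U)"
  using coeff_homD[OF germ_coeff_hom[OF F U]]
  by (intro coeff_homI) (simp_all add: C0_unit_def restrict_PiE_iff cong: restrict_cong)

lemma C0_unit_restr:
  assumes F: "presheaf K X F" and U: "openin X U" "openin X V" "V \<subseteq> U" "s \<in> carrier (sec F U)"
  shows "C0_unit X F V (restr F U V s) = restrict (C0_unit X F U s) V"
  using assms by (auto simp: C0_unit_def germ_restr[OF F] Int_absorb1 intro!: restrict_ext)

lemma C0_unit_morphism:
  assumes F: "presheaf K X F"
  shows "sheaf_morphism K X F (C0 X F) (C0_unit X F)"
  unfolding sheaf_morphism_def using C0_unit_coeff_hom[OF F] C0_unit_restr[OF F] by simp

lemma C0_map_coeff_hom: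
  assumes F: "presheaf K X F" and G: "presheaf K X G" and \<phi>: "sheaf_morphism K X F G \<phi>"
    and U: "U \<subseteq> topspace X"
  shows "C0_map X G \<phi> U \<in> coeff_hom K (sec (C0 X F) U) (sec (C0 X G) U)"
proof -
  have "stalk_map X G \<phi> y \<in> coeff_hom K (stalk X F y) (stalk X G y)" if "y \<in> U" for y
    using stalk_map_coeff_hom[OF F G \<phi>] that U by auto
  note sm = coeff_homD[OF this]
  show ?thesis
    by (rule coeff_homI)
      (simp_all add: C0_map_def restrict_PiE_iff PiE_mem[of _ U "\<lambda>y. carrier (stalk X F y)"] sm
        cong: restrict_cong)
qed

lemma C0_map_restrict: "V \<subseteq> U \<Longrightarrow> C0_map X G \<phi> V (restrict \<sigma> V) = restrict (C0_map X G \<phi> U \<sigma>) V"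
  by (auto simp: C0_map_def fun_eq_iff restrict_def)

lemma C0_map_morphism:
  assumes F: "presheaf K X F" and G: "presheaf K X G" and \<phi>: "sheaf_morphism K X F G \<phi>"
  shows "sheaf_morphism K X (C0 X F) (C0 X G) (C0_map X G \<phi>)"
  unfolding sheaf_morphism_def
  using C0_map_coeff_hom[OF F G \<phi> openin_subset] by (auto simp: C0_map_restrict)

text \<open>Pointwise this is \<open>stalk_map_germ\<close>. It provides both the square that
  induces the maps on Godement quotients and the last of the squares for the differential.\<close>

lemma C0_map_unit:
  assumes F: "presheaf K X F" and G: "presheaf K X G" and \<phi>: "sheaf_morphism K X F G \<phi>"
    and U: "openin X U" and s: "s \<in> carrier (sec F U)"
  shows "C0_map X G \<phi> U (C0_unit X F U s) = C0_unit X G U (\<phi> U s)"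
  using stalk_map_germ[OF F G \<phi> U _ s] by (simp add: C0_map_def C0_unit_def cong: restrict_cong)

subsection \<open>Sheafification\<close>

lemma sheafify_simps [simp]:
  "\<sigma> \<oplus>\<^bsub>sec (sheafify X P) U\<^esub> \<tau> = \<sigma> \<oplus>\<^bsub>sec (C0 X P) U\<^esub> \<tau>"
  "\<zero>\<^bsub>sec (sheafify X P) U\<^esub> = \<zero>\<^bsub>sec (C0 X P) U\<^esub>"
  "r \<odot>\<^bsub>sec (sheafify X P) U\<^esub> \<sigma> = r \<odot>\<^bsub>sec (C0 X P) U\<^esub> \<sigma>"
  "restr (sheafify X P) U V \<sigma> = restrict \<sigma> V"
  by (simp_all add: sheafify_def)

text \<open>The local condition is restated as membership of the restricted family in the image of
  the unit over \<open>V\<close>. That image is a submodule, which opens the way to the closure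
  properties.\<close>

lemma carrier_sheafify:
  "carrier (sec (sheafify X P) U) = {\<sigma> \<in> carrier (sec (C0 X P) U).
     \<forall>y\<in>U. \<exists>V. openin X V \<and> y \<in> V \<and> V \<subseteq> U \<and> restrict \<sigma> V \<in> C0_unit X P V ` carrier (sec P V)}"
proof -
  have *: "restrict \<sigma> V = C0_unit X P V s \<longleftrightarrow> (\<forall>z\<in>V. \<sigma> z = germ X P z V s)" for \<sigma> V s
    by (auto simp: C0_unit_def fun_eq_iff restrict_def)
  show ?thesis unfolding sheafify_def image_iff * Bex_def by simp
qed

lemma sheafify_shrink:
  assumes P: "presheaf K X P" and "restrict \<sigma> V \<in> C0_unit X P V ` carrier (sec P V)"
    "openin X V" "openin X W" "W \<subseteq> V"
  shows "restrict \<sigma> W \<in> C0_unit X P W ` carrier (sec P W)"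
proof -
  obtain s where s: "s \<in> carrier (sec P V)" "restrict \<sigma> V = C0_unit X P V s" using assms(2) by auto
  have "restrict \<sigma> W = restrict (restrict \<sigma> V) W" using assms(5) by (simp add: Int_absorb1)
  also have "\<dots> = C0_unit X P W (restr P V W s)" using C0_unit_restr[OF P assms(3-5) s(1)] s(2) by simp
  finally show ?thesis using presheaf_restr_closed[OF P assms(3-5) s(1)] by blast
qed

text \<open>Restriction to \<open>V\<close> is a homomorphism and the image of the unit over
  \<open>V\<close> is a submodule, so each operation may be checked on neighbourhoods where the
  given families come from sections.\<close>

lemma submod_sheafify:
  assumes P: "presheaf K X P" and U: "openin X U"
  shows "submod K (sec (C0 X P) U) (carrier (sec (sheafify X P) U))"
proof -
  note C = presheaf_C0[OF P]
  have im: "submod K (sec (C0 X P) V) (C0_unit X P V ` carrier (sec P V))" if "openin X V" for V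
    using submod_image[OF presheaf_sec[OF P that] presheaf_sec[OF C that] C0_unit_coeff_hom[OF P that]] .
  have loc: "restr (C0 X P) U V \<in> coeff_hom K (sec (C0 X P) U) (sec (C0 X P) V)"
    if "openin X V" "V \<subseteq> U" for V using presheaf_restr_hom[OF C U that] .
  have cU: "coeff_object K (sec (C0 X P) U)" using presheaf_sec[OF C U] .
  let ?loc = "\<lambda>\<sigma> y V. openin X V \<and> y \<in> V \<and> V \<subseteq> U \<and>
    restr (C0 X P) U V \<sigma> \<in> C0_unit X P V ` carrier (sec P V)"
  have car: "\<sigma> \<in> carrier (sec (sheafify X P) U) \<longleftrightarrow>
      \<sigma> \<in> carrier (sec (C0 X P) U) \<and> (\<forall>y\<in>U. \<exists>V. ?loc \<sigma> y V)" for \<sigma>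
    by (simp add: carrier_sheafify)
  show ?thesis
    unfolding submod_def
  proof (intro conjI ballI)
    show "carrier (sec (sheafify X P) U) \<subseteq> carrier (sec (C0 X P) U)" using car by blast
    show "\<zero>\<^bsub>sec (C0 X P) U\<^esub> \<in> carrier (sec (sheafify X P) U)"
      unfolding car
      using coeff_object_zero[OF cU] coeff_hom_zero[OF cU presheaf_sec[OF C U] loc[OF U]] im[OF U] U
      unfolding submod_def by auto
    fix \<sigma> assume \<sigma>: "\<sigma> \<in> carrier (sec (sheafify X P) U)"
    then have \<sigma>C: "\<sigma> \<in> carrier (sec (C0 X P) U)" by (simp only: car)
    show "\<ominus>\<^bsub>sec (C0 X P) U\<^esub> \<sigma> \<in> carrier (sec (sheafify X P) U)"
      unfolding car
    proof (intro conjI ballI)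
      show "\<ominus>\<^bsub>sec (C0 X P) U\<^esub> \<sigma> \<in> carrier (sec (C0 X P) U)" using cU \<sigma>C by (rule coeff_object_minus)
      fix y assume "y \<in> U"
      then obtain V where V: "?loc \<sigma> y V" using \<sigma> unfolding car by blast
      then have "restr (C0 X P) U V (\<ominus>\<^bsub>sec (C0 X P) U\<^esub> \<sigma>) = \<ominus>\<^bsub>sec (C0 X P) V\<^esub> restr (C0 X P) U V \<sigma>"
        using coeff_hom_minus[OF cU presheaf_sec[OF C] loc \<sigma>C] by blast
      then show "\<exists>V. ?loc (\<ominus>\<^bsub>sec (C0 X P) U\<^esub> \<sigma>) y V"
        using V im[of V] unfolding submod_def by metis
    qed
    show "r \<odot>\<^bsub>sec (C0 X P) U\<^esub> \<sigma> \<in> carrier (sec (sheafify X P) U)" if r: "r \<in> scalars K" for r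
      unfolding car
    proof (intro conjI ballI)
      show "r \<odot>\<^bsub>sec (C0 X P) U\<^esub> \<sigma> \<in> carrier (sec (C0 X P) U)"
        using cU r \<sigma>C by (rule coeff_object_smult)
      fix y assume "y \<in> U"
      then obtain V where V: "?loc \<sigma> y V" using \<sigma> unfolding car by blast
      then have "restr (C0 X P) U V (r \<odot>\<^bsub>sec (C0 X P) U\<^esub> \<sigma>) = r \<odot>\<^bsub>sec (C0 X P) V\<^esub> restr (C0 X P) U V \<sigma>"
        using coeff_homD(3)[OF loc r \<sigma>C] by blast
      then show "\<exists>V. ?loc (r \<odot>\<^bsub>sec (C0 X P) U\<^esub> \<sigma>) y V"
        using V im[of V] r unfolding submod_def by metis
    qed
    fix \<tau> assume \<tau>: "\<tau> \<in> carrier (sec (sheafify X P) U)"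
    then have \<tau>C: "\<tau> \<in> carrier (sec (C0 X P) U)" by (simp only: car)
    show "\<sigma> \<oplus>\<^bsub>sec (C0 X P) U\<^esub> \<tau> \<in> carrier (sec (sheafify X P) U)"
      unfolding car
    proof (intro conjI ballI)
      show "\<sigma> \<oplus>\<^bsub>sec (C0 X P) U\<^esub> \<tau> \<in> carrier (sec (C0 X P) U)"
        using cU \<sigma>C \<tau>C by (rule coeff_object_add)
      fix y assume "y \<in> U"
      then obtain V V' where V: "?loc \<sigma> y V" "?loc \<tau> y V'" using \<sigma> \<tau> unfolding car by blast
      \<comment> \<open>The two families come from sections over different neighbourhoods;
        \<open>sheafify_shrink\<close> moves both to the intersection.\<close>
      define W where "W = V \<inter> V'"
      have W: "openin X W" "y \<in> W" "W \<subseteq> V" "W \<subseteq> V'" "W \<subseteq> U" using V by (auto simp: W_def)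
      have "restr (C0 X P) U W \<sigma> \<in> C0_unit X P W ` carrier (sec P W)"
        "restr (C0 X P) U W \<tau> \<in> C0_unit X P W ` carrier (sec P W)"
        using V W sheafify_shrink[OF P, of \<sigma> V W] sheafify_shrink[OF P, of \<tau> V' W] by simp_all
      then have "restr (C0 X P) U W \<sigma> \<oplus>\<^bsub>sec (C0 X P) W\<^esub> restr (C0 X P) U W \<tau>
          \<in> C0_unit X P W ` carrier (sec P W)"
        using im[OF W(1)] unfolding submod_def by blast
      then have "?loc (\<sigma> \<oplus>\<^bsub>sec (C0 X P) U\<^esub> \<tau>) y W"
        using W coeff_homD(2)[OF loc[OF W(1,5)] \<sigma>C \<tau>C] by (simp del: C0_simps)
      then show "\<exists>V. ?loc (\<sigma> \<oplus>\<^bsub>sec (C0 X P) U\<^esub> \<tau>) y V" ..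
    qed
  qed
qed

lemma coeff_object_sheafify:
  assumes P: "presheaf K X P" and U: "openin X U"
  shows "coeff_object K (sec (sheafify X P) U)"
proof -
  have "sec (sheafify X P) U = (sec (C0 X P) U)\<lparr>carrier := carrier (sec (sheafify X P) U)\<rparr>"
    by (simp add: sheafify_def)
  then show ?thesis
    using coeff_object_submod[OF presheaf_sec[OF presheaf_C0[OF P] U] submod_sheafify[OF P U]] by simp
qed

lemma sheafify_restrict_closed:
  assumes P: "presheaf K X P" and U: "openin X U" "openin X V" "V \<subseteq> U"
    and \<sigma>: "\<sigma> \<in> carrier (sec (sheafify X P) U)"
  shows "restrict \<sigma> V \<in> carrier (sec (sheafify X P) V)"
  unfolding carrier_sheafify
proof (intro CollectI conjI ballI)
  show "restrict \<sigma> V \<in> carrier (sec (C0 X P) V)"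
    using \<sigma> U(3) by (auto simp: carrier_sheafify)
  fix y assume y: "y \<in> V"
  then obtain W where W: "openin X W" "y \<in> W" "restrict \<sigma> W \<in> C0_unit X P W ` carrier (sec P W)"
    using \<sigma> U(3) unfolding carrier_sheafify by blast
  then show "\<exists>W. openin X W \<and> y \<in> W \<and> W \<subseteq> V \<and>
      restrict (restrict \<sigma> V) W \<in> C0_unit X P W ` carrier (sec P W)"
    using U(2) y sheafify_shrink[OF P W(3,1), of "V \<inter> W"]
    by (intro exI[of _ "V \<inter> W"]) (auto simp: Int_absorb1)
qed

lemma presheaf_sheafify:
  assumes P: "presheaf K X P"
  shows "presheaf K X (sheafify X P)"
  unfolding presheaf_def
proof (intro conjI allI impI ballI)
  note C = presheaf_C0[OF P]
  fix U assume U: "openin X U"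
  show "coeff_object K (sec (sheafify X P) U)" by (rule coeff_object_sheafify[OF P U])
  have sub: "\<sigma> \<in> carrier (sec (C0 X P) U)" if "\<sigma> \<in> carrier (sec (sheafify X P) U)" for \<sigma>
    using that by (simp add: carrier_sheafify)
  show "restr (sheafify X P) U U \<sigma> = \<sigma>" if "\<sigma> \<in> carrier (sec (sheafify X P) U)" for \<sigma>
    using presheaf_restr_id[OF C U sub[OF that]] by simp
  fix V assume V: "openin X V" "V \<subseteq> U"
  show "restr (sheafify X P) U V \<in> coeff_hom K (sec (sheafify X P) U) (sec (sheafify X P) V)"
    by (rule coeff_homI)
      (use sheafify_restrict_closed[OF P U V] coeff_homD(2,3)[OF presheaf_restr_hom[OF C U V]] sub
        in simp_all)
qed (auto simp: Int_absorb1)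

lemma C0_unit_sheafify_morphism:
  assumes P: "presheaf K X P"
  shows "sheaf_morphism K X P (sheafify X P) (C0_unit X P)"
proof -
  have "C0_unit X P U s \<in> carrier (sec (sheafify X P) U)"
    if U: "openin X U" and s: "s \<in> carrier (sec P U)" for U s
  proof -
    have "C0_unit X P U s \<in> carrier (sec (C0 X P) U)"
      using coeff_homD(1)[OF C0_unit_coeff_hom[OF P U] s] .
    moreover have "restrict (C0_unit X P U s) U = C0_unit X P U s"
      by (simp add: C0_unit_def)
    ultimately show ?thesis unfolding carrier_sheafify using U s by blast
  qed
  then show ?thesis
    unfolding sheaf_morphism_def
    using coeff_homD(2,3)[OF C0_unit_coeff_hom[OF P]] C0_unit_restr[OF P]
    by (auto intro!: coeff_homI)
qed

text \<open>Where a family comes from a section \<open>s\<close> over \<open>V\<close>, its image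
  comes from \<open>\<phi> V s\<close> by naturality of the unit, so the local condition is
  preserved.\<close>

lemma C0_map_sheafify_morphism:
  assumes P: "presheaf K X P" and Q: "presheaf K X Q" and \<phi>: "sheaf_morphism K X P Q \<phi>"
  shows "sheaf_morphism K X (sheafify X P) (sheafify X Q) (C0_map X Q \<phi>)"
proof -
  note C = C0_map_morphism[OF P Q \<phi>]
  have "C0_map X Q \<phi> U \<sigma> \<in> carrier (sec (sheafify X Q) U)"
    if U: "openin X U" and \<sigma>: "\<sigma> \<in> carrier (sec (sheafify X P) U)" for U \<sigma>
    unfolding carrier_sheafify
  proof (intro CollectI conjI ballI)
    have "\<sigma> \<in> carrier (sec (C0 X P) U)" using \<sigma> by (simp add: carrier_sheafify)
    then show "C0_map X Q \<phi> U \<sigma> \<in> carrier (sec (C0 X Q) U)"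
      by (rule coeff_homD(1)[OF sheaf_morphism_hom[OF C U]])
    fix y assume "y \<in> U"
    then obtain V s where V: "openin X V" "y \<in> V" "V \<subseteq> U" "s \<in> carrier (sec P V)"
      "restrict \<sigma> V = C0_unit X P V s" using \<sigma> unfolding carrier_sheafify by blast
    have "restrict (C0_map X Q \<phi> U \<sigma>) V = C0_unit X Q V (\<phi> V s)"
      using C0_map_unit[OF P Q \<phi> V(1,4)] V(5) C0_map_restrict[OF V(3)] by metis
    then show "\<exists>V. openin X V \<and> y \<in> V \<and> V \<subseteq> U \<and>
        restrict (C0_map X Q \<phi> U \<sigma>) V \<in> C0_unit X Q V ` carrier (sec Q V)"
      using V coeff_homD(1)[OF sheaf_morphism_hom[OF \<phi> V(1)] V(4)] by blast
  qed
  moreover have "carrier (sec (sheafify X P) U) \<subseteq> carrier (sec (C0 X P) U)" for U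
    by (auto simp: carrier_sheafify)
  ultimately show ?thesis
    unfolding sheaf_morphism_def
    using coeff_homD(2,3)[OF sheaf_morphism_hom[OF C]] sheaf_morphism_restr[OF C]
    by (auto intro!: coeff_homI simp del: C0_simps simp: subset_iff C0_map_restrict)
qed

subsection \<open>Cokernels\<close>

lemma sheaf_morphism_comp:
  "sheaf_morphism K X F G \<phi> \<Longrightarrow> sheaf_morphism K X G H \<psi> \<Longrightarrow>
     sheaf_morphism K X F H (\<lambda>U s. \<psi> U (\<phi> U s))"
  unfolding sheaf_morphism_def by (auto intro: coeff_hom_comp simp: coeff_homD(1))

lemma coker_presheaf_simps:
  "sec (coker_presheaf A B \<phi>) U = quot_module (sec B U) (\<phi> U ` carrier (sec A U))"
  "restr (coker_presheaf A B \<phi>) U V =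
     quot_map (sec B V) (\<phi> V ` carrier (sec A V)) (restr B U V)"
  by (simp_all add: coker_presheaf_def)

lemma submod_coker:
  assumes "presheaf K X A" "presheaf K X B" "sheaf_morphism K X A B \<phi>" "openin X U"
  shows "submod K (sec B U) (\<phi> U ` carrier (sec A U))"
  using assms by (intro submod_image presheaf_sec sheaf_morphism_hom)

lemma coker_restr_image:
  assumes A: "presheaf K X A" and \<phi>: "sheaf_morphism K X A B \<phi>"
    and U: "openin X U" "openin X V" "V \<subseteq> U"
  shows "restr B U V ` \<phi> U ` carrier (sec A U) \<subseteq> \<phi> V ` carrier (sec A V)"
  using sheaf_morphism_restr[OF \<phi> U] presheaf_restr_closed[OF A U] by force

text \<open>\<open>restr B U V\<close> sends the image of \<open>\<phi> U\<close> into the image of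
  \<open>\<phi> V\<close>, so restriction of cosets is computed on representatives. Through this
  rule the identity and composition laws of the cokernel presheaf reduce to those of
  \<open>B\<close>.\<close>

lemma coker_restr_rcos:
  assumes A: "presheaf K X A" and B: "presheaf K X B" and \<phi>: "sheaf_morphism K X A B \<phi>"
    and U: "openin X U" "openin X V" "V \<subseteq> U" and x: "x \<in> carrier (sec B U)"
  shows "restr (coker_presheaf A B \<phi>) U V (\<phi> U ` carrier (sec A U) +>\<^bsub>sec B U\<^esub> x) =
    \<phi> V ` carrier (sec A V) +>\<^bsub>sec B V\<^esub> restr B U V x"
  unfolding coker_presheaf_simps
  by (rule quot_map_rcos[OF presheaf_sec[OF B U(1)] submod_coker[OF A B \<phi> U(1)]
        presheaf_sec[OF B U(2)] submod_coker[OF A B \<phi> U(2)] presheaf_restr_hom[OF B U]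
        coker_restr_image[OF A \<phi> U] x])

lemma presheaf_coker:
  assumes A: "presheaf K X A" and B: "presheaf K X B" and \<phi>: "sheaf_morphism K X A B \<phi>"
  shows "presheaf K X (coker_presheaf A B \<phi>)"
proof -
  note N = submod_coker[OF A B \<phi>] and obj = presheaf_sec[OF B] and r = coker_restr_rcos[OF A B \<phi>]
  show ?thesis
    unfolding presheaf_def
  proof (intro conjI allI impI ballI)
    fix U assume U: "openin X U"
    show "coeff_object K (sec (coker_presheaf A B \<phi>) U)"
      unfolding coker_presheaf_simps by (rule coeff_object_quot_module[OF obj[OF U] N[OF U]])
    show "restr (coker_presheaf A B \<phi>) U U c = c" if "c \<in> carrier (sec (coker_presheaf A B \<phi>) U)" for c
      using that r[OF U U] presheaf_restr_id[OF B U]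
      by (auto simp: coker_presheaf_simps(1) carrier_quot_module)
    fix V assume V: "openin X V" "V \<subseteq> U"
    show "restr (coker_presheaf A B \<phi>) U V \<in>
        coeff_hom K (sec (coker_presheaf A B \<phi>) U) (sec (coker_presheaf A B \<phi>) V)"
      unfolding coker_presheaf_simps
      by (rule quot_map_coeff_hom[OF obj[OF U] N[OF U] obj[OF V(1)] N[OF V(1)]
            presheaf_restr_hom[OF B U V] coker_restr_image[OF A \<phi> U V]])
  next
    fix U V W c
    assume *: "openin X U" "openin X V" "openin X W" "W \<subseteq> V" "V \<subseteq> U"
      and c: "c \<in> carrier (sec (coker_presheaf A B \<phi>) U)"
    obtain x where x: "x \<in> carrier (sec B U)" "c = \<phi> U ` carrier (sec A U) +>\<^bsub>sec B U\<^esub> x"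
      using c by (auto simp: coker_presheaf_simps(1) carrier_quot_module)
    show "restr (coker_presheaf A B \<phi>) V W (restr (coker_presheaf A B \<phi>) U V c) =
        restr (coker_presheaf A B \<phi>) U W c"
      using * x(1) unfolding x(2)
      by (simp add: r presheaf_restr_closed[OF B] presheaf_restr_comp[OF B] subset_trans)
  qed
qed

lemma coker_rcos_morphism:
  assumes A: "presheaf K X A" and B: "presheaf K X B" and \<phi>: "sheaf_morphism K X A B \<phi>"
  shows "sheaf_morphism K X B (coker_presheaf A B \<phi>)
    (\<lambda>U x. \<phi> U ` carrier (sec A U) +>\<^bsub>sec B U\<^esub> x)"
  unfolding sheaf_morphism_def
proof (intro conjI allI impI ballI)
  fix U assume U: "openin X U"
  show "(\<lambda>x. \<phi> U ` carrier (sec A U) +>\<^bsub>sec B U\<^esub> x) \<in>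
      coeff_hom K (sec B U) (sec (coker_presheaf A B \<phi>) U)"
    unfolding coker_presheaf_simps
    by (rule rcos_coeff_hom[OF presheaf_sec[OF B U] submod_coker[OF A B \<phi> U]])
qed (simp add: coker_restr_rcos[OF A B \<phi>])

lemma coker_proj_morphism:
  assumes A: "presheaf K X A" and B: "presheaf K X B" and \<phi>: "sheaf_morphism K X A B \<phi>"
  shows "sheaf_morphism K X B (coker_sheaf X A B \<phi>) (coker_proj X A B \<phi>)"
  using sheaf_morphism_comp[OF coker_rcos_morphism[OF assms]
      C0_unit_sheafify_morphism[OF presheaf_coker[OF assms]]]
  unfolding coker_sheaf_def coker_proj_def[abs_def] .

section \<open>Functoriality of cokernels in a commutative square\<close>

context
  fixes K :: "'r ring option" and X :: "'p topology"
    and A :: "('p, 'r, 'a) presheaf" and B :: "('p, 'r, 'b) presheaf" and \<phi>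
    and A' :: "('p, 'r, 'c) presheaf" and B' :: "('p, 'r, 'd) presheaf" and \<phi>' \<alpha> \<beta>
  assumes A: "presheaf K X A" and B: "presheaf K X B" and \<phi>: "sheaf_morphism K X A B \<phi>"
    and A': "presheaf K X A'" and B': "presheaf K X B'" and \<phi>': "sheaf_morphism K X A' B' \<phi>'"
    and \<alpha>: "sheaf_morphism K X A A' \<alpha>" and \<beta>: "sheaf_morphism K X B B' \<beta>"
    and comm: "\<forall>U s. openin X U \<longrightarrow> s \<in> carrier (sec A U) \<longrightarrow> \<beta> U (\<phi> U s) = \<phi>' U (\<alpha> U s)"
begin

private lemma image: "openin X U \<Longrightarrow> \<beta> U ` \<phi> U ` carrier (sec A U) \<subseteq> \<phi>' U ` carrier (sec A' U)"
  using comm coeff_homD(1)[OF sheaf_morphism_hom[OF \<alpha>]] by fastforce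

text \<open>The square \<open>comm\<close> places the \<open>\<beta>\<close>-image of the image of
  \<open>\<phi>\<close> inside the image of \<open>\<phi>'\<close>, so \<open>\<beta>\<close> acts
  on cosets.\<close>

lemma coker_map_rcos:
  assumes U: "openin X U" and x: "x \<in> carrier (sec B U)"
  shows "quot_map (sec B' U) (\<phi>' U ` carrier (sec A' U)) (\<beta> U)
      (\<phi> U ` carrier (sec A U) +>\<^bsub>sec B U\<^esub> x) = \<phi>' U ` carrier (sec A' U) +>\<^bsub>sec B' U\<^esub> \<beta> U x"
  by (rule quot_map_rcos[OF presheaf_sec[OF B U] submod_coker[OF A B \<phi> U] presheaf_sec[OF B' U]
        submod_coker[OF A' B' \<phi>' U] sheaf_morphism_hom[OF \<beta> U] image[OF U] x])

lemma coker_map_morphism: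
  "sheaf_morphism K X (coker_presheaf A B \<phi>) (coker_presheaf A' B' \<phi>')
     (\<lambda>U. quot_map (sec B' U) (\<phi>' U ` carrier (sec A' U)) (\<beta> U))"
  unfolding sheaf_morphism_def
proof (intro conjI allI impI ballI)
  fix U assume U: "openin X U"
  show "quot_map (sec B' U) (\<phi>' U ` carrier (sec A' U)) (\<beta> U) \<in>
      coeff_hom K (sec (coker_presheaf A B \<phi>) U) (sec (coker_presheaf A' B' \<phi>') U)"
    unfolding coker_presheaf_simps
    by (rule quot_map_coeff_hom[OF presheaf_sec[OF B U] submod_coker[OF A B \<phi> U] presheaf_sec[OF B' U]
          submod_coker[OF A' B' \<phi>' U] sheaf_morphism_hom[OF \<beta> U] image[OF U]])
  fix V c assume V: "openin X V" "V \<subseteq> U" and c: "c \<in> carrier (sec (coker_presheaf A B \<phi>) U)"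
  obtain x where x: "x \<in> carrier (sec B U)" "c = \<phi> U ` carrier (sec A U) +>\<^bsub>sec B U\<^esub> x"
    using c by (auto simp: coker_presheaf_simps(1) carrier_quot_module)
  show "quot_map (sec B' V) (\<phi>' V ` carrier (sec A' V)) (\<beta> V) (restr (coker_presheaf A B \<phi>) U V c) =
      restr (coker_presheaf A' B' \<phi>') U V (quot_map (sec B' U) (\<phi>' U ` carrier (sec A' U)) (\<beta> U) c)"
    unfolding x(2)
    using U V x(1) coeff_homD(1)[OF sheaf_morphism_hom[OF \<beta> U] x(1)]
    by (simp add: coker_restr_rcos[OF A B \<phi>] coker_restr_rcos[OF A' B' \<phi>'] coker_map_rcos
        presheaf_restr_closed[OF B] sheaf_morphism_restr[OF \<beta>])
qed

text \<open>The projection to the cokernel sheaf is the coset map followed by the unit of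
  sheafification; the former is natural by \<open>coker_map_rcos\<close>, the latter by
  \<open>C0_map_unit\<close>.\<close>

lemma coker_proj_natural:
  assumes U: "openin X U" and x: "x \<in> carrier (sec B U)"
  shows "C0_map X (coker_presheaf A' B' \<phi>')
      (\<lambda>U. quot_map (sec B' U) (\<phi>' U ` carrier (sec A' U)) (\<beta> U)) U (coker_proj X A B \<phi> U x) =
    coker_proj X A' B' \<phi>' U (\<beta> U x)"
  unfolding coker_proj_def
  using coeff_homD(1)[OF sheaf_morphism_hom[OF coker_rcos_morphism[OF A B \<phi>] U] x]
  by (simp add: C0_map_unit[OF presheaf_coker[OF A B \<phi>] presheaf_coker[OF A' B' \<phi>']
        coker_map_morphism U] coker_map_rcos[OF U x])

end

subsection \<open>Transport along injections\<close>

lemma carrier_transport: "carrier (sec (transport e F) U) = e ` carrier (sec F U)"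
  by (simp add: transport_def Let_def)

lemma zero_transport: "\<zero>\<^bsub>sec (transport e F) U\<^esub> = e \<zero>\<^bsub>sec F U\<^esub>"
  by (simp add: transport_def Let_def)

context
  fixes K :: "'r ring option" and X :: "'p topology" and F :: "('p, 'r, 'a) presheaf"
    and e :: "'a \<Rightarrow> 'b"
  assumes F: "presheaf K X F" and inj: "\<forall>U. openin X U \<longrightarrow> inj_on e (carrier (sec F U))"
begin

text \<open>Over an open set \<open>inv_into\<close> undoes \<open>e\<close> because
  \<open>e\<close> is injective on that carrier. Injectivity is asked for one section module at a
  time, since an encoding by chosen representatives cannot separate arbitrary sets.\<close>

lemma transport_restr:
  "openin X U \<Longrightarrow> s \<in> carrier (sec F U) \<Longrightarrow> restr (transport e F) U V (e s) = e (restr F U V s)"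
  by (simp add: transport_def inv_into_f_f[OF inj[rule_format]])

lemma transport_coeff_hom:
  "openin X U \<Longrightarrow> e \<in> coeff_hom K (sec F U) (sec (transport e F) U)"
  by (rule coeff_homI) (simp_all add: transport_def Let_def inv_into_f_f[OF inj[rule_format]])

lemma presheaf_transport: "presheaf K X (transport e F)"
  unfolding presheaf_def
proof (intro conjI allI impI ballI)
  fix U assume U: "openin X U"
  show "coeff_object K (sec (transport e F) U)"
    by (rule coeff_object_image[OF presheaf_sec[OF F U] transport_coeff_hom[OF U]])
      (simp_all add: zero_transport carrier_transport)
  show "restr (transport e F) U U a = a" if "a \<in> carrier (sec (transport e F) U)" for a
    using that U by (auto simp: carrier_transport transport_restr presheaf_restr_id[OF F])
  fix V assume V: "openin X V" "V \<subseteq> U"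
  show "restr (transport e F) U V \<in> coeff_hom K (sec (transport e F) U) (sec (transport e F) V)"
  proof (rule coeff_hom_factor[OF presheaf_sec[OF F U] transport_coeff_hom[OF U] carrier_transport])
    show "(\<lambda>s. restr (transport e F) U V (e s)) \<in> coeff_hom K (sec F U) (sec (transport e F) V)"
      by (rule coeff_hom_cong[OF presheaf_sec[OF F U] _
            coeff_hom_comp[OF presheaf_restr_hom[OF F U V] transport_coeff_hom[OF V(1)]]])
        (simp add: transport_restr[OF U])
  qed
next
  fix U V W a
  assume "openin X U" "openin X V" "openin X W" "W \<subseteq> V" "V \<subseteq> U" "a \<in> carrier (sec (transport e F) U)"
  then show "restr (transport e F) V W (restr (transport e F) U V a) = restr (transport e F) U W a"
    by (auto simp: carrier_transport transport_restr presheaf_restr_closed[OF F]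
        presheaf_restr_comp[OF F])
qed

lemma transport_map_apply:
  "openin X U \<Longrightarrow> s \<in> carrier (sec F U) \<Longrightarrow> transport_map e e' F \<phi> U (e s) = e' (\<phi> U s)"
  by (simp add: transport_map_def inv_into_f_f[OF inj[rule_format]])

end

lemma transport_map_morphism:
  assumes F: "presheaf K X F" and inj: "\<forall>U. openin X U \<longrightarrow> inj_on e (carrier (sec F U))"
    and G: "presheaf K X G" and inj': "\<forall>U. openin X U \<longrightarrow> inj_on e' (carrier (sec G U))"
    and \<phi>: "sheaf_morphism K X F G \<phi>"
  shows "sheaf_morphism K X (transport e F) (transport e' G) (transport_map e e' F \<phi>)"
  unfolding sheaf_morphism_def
proof (intro conjI allI impI ballI)
  note app = transport_map_apply[OF F inj]
  fix U assume U: "openin X U"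
  show "transport_map e e' F \<phi> U \<in> coeff_hom K (sec (transport e F) U) (sec (transport e' G) U)"
  proof (rule coeff_hom_factor[OF presheaf_sec[OF F U] transport_coeff_hom[OF F inj U]
        carrier_transport])
    show "(\<lambda>s. transport_map e e' F \<phi> U (e s)) \<in> coeff_hom K (sec F U) (sec (transport e' G) U)"
      by (rule coeff_hom_cong[OF presheaf_sec[OF F U] _
            coeff_hom_comp[OF sheaf_morphism_hom[OF \<phi> U] transport_coeff_hom[OF G inj' U]]])
        (simp_all add: app[OF U])
  qed
  fix V a assume V: "openin X V" "V \<subseteq> U" and a: "a \<in> carrier (sec (transport e F) U)"
  obtain s where s: "s \<in> carrier (sec F U)" "a = e s" using a by (auto simp: carrier_transport)
  have "restr F U V s \<in> carrier (sec F V)" "\<phi> U s \<in> carrier (sec G U)"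
    using presheaf_restr_closed[OF F U V s(1)] coeff_homD(1)[OF sheaf_morphism_hom[OF \<phi> U] s(1)] .
  then show "transport_map e e' F \<phi> V (restr (transport e F) U V a) =
      restr (transport e' G) U V (transport_map e e' F \<phi> U a)"
    using U V s by (simp add: app transport_restr[OF F inj] transport_restr[OF G inj']
        sheaf_morphism_restr[OF \<phi>])
qed

subsection \<open>Vanishing of stalks\<close>

text \<open>A germ is zero exactly when a representative restricts to zero on some neighbourhood.
  The right-hand side speaks of sections alone, and in this form vanishing can be followed through
  quotients, sheafification and transport.\<close>

lemma stalk_trivial_iff:
  assumes F: "presheaf K X F" and y: "y \<in> topspace X"
  shows "carrier (stalk X F y) = {\<zero>\<^bsub>stalk X F y\<^esub>} \<longleftrightarrow>
    (\<forall>U s. openin X U \<longrightarrow> y \<in> U \<longrightarrow> s \<in> carrier (sec F U) \<longrightarrow>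
       (\<exists>W. openin X W \<and> y \<in> W \<and> W \<subseteq> U \<and> restr F U W s = \<zero>\<^bsub>sec F W\<^esub>))"
    (is "?L \<longleftrightarrow> ?R")
proof
  assume L: ?L
  show ?R
  proof (intro allI impI)
    fix U s assume U: "openin X U" "y \<in> U" "s \<in> carrier (sec F U)"
    have z: "\<zero>\<^bsub>sec F U\<^esub> \<in> carrier (sec F U)" using coeff_object_zero[OF presheaf_sec[OF F U(1)]] .
    have "germ X F y U s = germ X F y U \<zero>\<^bsub>sec F U\<^esub>"
      using germ_in_stalk[OF U] L stalk_zero[OF F U(1,2)] by simp
    then obtain W where W: "openin X W" "y \<in> W" "W \<subseteq> U" "restr F U W s = restr F U W \<zero>\<^bsub>sec F U\<^esub>"
      using germ_eq_iff[OF F U U(1,2) z] by auto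
    then show "\<exists>W. openin X W \<and> y \<in> W \<and> W \<subseteq> U \<and> restr F U W s = \<zero>\<^bsub>sec F W\<^esub>"
      using coeff_hom_zero[OF presheaf_sec[OF F U(1)] presheaf_sec[OF F W(1)]
          presheaf_restr_hom[OF F U(1) W(1,3)]] by auto
  qed
next
  assume R: ?R
  have "germ X F y U s = \<zero>\<^bsub>stalk X F y\<^esub>" if U: "openin X U" "y \<in> U" "s \<in> carrier (sec F U)" for U s
  proof -
    obtain W where W: "openin X W" "y \<in> W" "W \<subseteq> U" "restr F U W s = \<zero>\<^bsub>sec F W\<^esub>"
      using R U by blast
    then show ?thesis using germ_restr[OF F U(1) W(1,3,2) U(3)] stalk_zero[OF F W(1,2)] by simp
  qed
  then show ?L
    using coeff_object_zero[OF coeff_object_stalk[OF F y]] by (auto simp: carrier_stalk)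
qed

text \<open>Near \<open>y\<close> a section of the sheafification is the unit of a section
  \<open>s\<close> of \<open>P\<close>; on a neighbourhood where \<open>s\<close> becomes zero, the
  family is zero as well.\<close>

lemma stalk_trivial_sheafify:
  assumes P: "presheaf K X P" and y: "y \<in> topspace X"
    and triv: "carrier (stalk X P y) = {\<zero>\<^bsub>stalk X P y\<^esub>}"
  shows "carrier (stalk X (sheafify X P) y) = {\<zero>\<^bsub>stalk X (sheafify X P) y\<^esub>}"
  unfolding stalk_trivial_iff[OF presheaf_sheafify[OF P] y]
proof (intro allI impI)
  fix U \<sigma> assume U: "openin X U" "y \<in> U" and \<sigma>: "\<sigma> \<in> carrier (sec (sheafify X P) U)"
  then obtain V s where V: "openin X V" "y \<in> V" "V \<subseteq> U" "s \<in> carrier (sec P V)"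
    "restrict \<sigma> V = C0_unit X P V s" unfolding carrier_sheafify by blast
  obtain W where W: "openin X W" "y \<in> W" "W \<subseteq> V" "restr P V W s = \<zero>\<^bsub>sec P W\<^esub>"
    using triv V(1,2,4) unfolding stalk_trivial_iff[OF P y] by blast
  have "restrict \<sigma> W = restrict (restrict \<sigma> V) W" using W(3) by (simp add: Int_absorb1)
  also have "\<dots> = C0_unit X P W \<zero>\<^bsub>sec P W\<^esub>"
    using C0_unit_restr[OF P V(1) W(1,3) V(4)] V(5) W(4) by simp
  also have "\<dots> = \<zero>\<^bsub>sec (C0 X P) W\<^esub>"
    using coeff_hom_zero[OF presheaf_sec[OF P W(1)] presheaf_sec[OF presheaf_C0[OF P] W(1)]
        C0_unit_coeff_hom[OF P W(1)]] .
  finally show "\<exists>W. openin X W \<and> y \<in> W \<and> W \<subseteq> U \<and>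
      restr (sheafify X P) U W \<sigma> = \<zero>\<^bsub>sec (sheafify X P) W\<^esub>"
    using W V(3) by (intro exI[of _ W]) auto
qed

lemma stalk_trivial_transport:
  assumes F: "presheaf K X F" and inj: "\<forall>U. openin X U \<longrightarrow> inj_on e (carrier (sec F U))"
    and y: "y \<in> topspace X" and triv: "carrier (stalk X F y) = {\<zero>\<^bsub>stalk X F y\<^esub>}"
  shows "carrier (stalk X (transport e F) y) = {\<zero>\<^bsub>stalk X (transport e F) y\<^esub>}"
  unfolding stalk_trivial_iff[OF presheaf_transport[OF F inj] y]
proof (intro allI impI)
  fix U a assume U: "openin X U" "y \<in> U" and a: "a \<in> carrier (sec (transport e F) U)"
  obtain s where s: "s \<in> carrier (sec F U)" "a = e s" using a by (auto simp: carrier_transport)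
  obtain W where W: "openin X W" "y \<in> W" "W \<subseteq> U" "restr F U W s = \<zero>\<^bsub>sec F W\<^esub>"
    using triv U s unfolding stalk_trivial_iff[OF F y] by blast
  then show "\<exists>W. openin X W \<and> y \<in> W \<and> W \<subseteq> U \<and>
      restr (transport e F) U W a = \<zero>\<^bsub>sec (transport e F) W\<^esub>"
    using U s by (intro exI[of _ W]) (simp add: transport_restr[OF F inj] zero_transport)
qed

section \<open>The quotient of the germ families by the sections\<close>

abbreviation godement_quotient ::
    "'p topology \<Rightarrow> ('p, 'r, 'a) presheaf \<Rightarrow> ('p, 'r, ('p \<Rightarrow> ('p set \<times> 'a) set) set) presheaf" where
  "godement_quotient X P \<equiv> coker_presheaf P (C0 X P) (C0_unit X P)"

lemma presheaf_godement_quotient: "presheaf K X P \<Longrightarrow> presheaf K X (godement_quotient X P)"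
  by (intro presheaf_coker presheaf_C0 C0_unit_morphism)

text \<open>
  If the stalks of \<open>P\<close> vanish near \<open>y\<close> except possibly at \<open>y\<close> itself, then near \<open>y\<close> a family of germs is
  determined by its value at \<open>y\<close>, and so it is the image of a section of \<open>P\<close>.
\<close>

lemma stalk_trivial_godement_quotient:
  assumes P: "presheaf K X P" and y: "y \<in> topspace X"
    and near: "\<And>W. openin X W \<Longrightarrow> y \<in> W \<Longrightarrow> \<exists>V. openin X V \<and> y \<in> V \<and> V \<subseteq> W \<and>
      (\<forall>z\<in>V - {y}. carrier (stalk X P z) = {\<zero>\<^bsub>stalk X P z\<^esub>})"
  shows "carrier (stalk X (godement_quotient X P) y) = {\<zero>\<^bsub>stalk X (godement_quotient X P) y\<^esub>}"
  unfolding stalk_trivial_iff[OF presheaf_godement_quotient[OF P] y]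
proof (intro allI impI)
  note C = presheaf_C0[OF P] and u = C0_unit_morphism[OF P]
  fix U c assume U: "openin X U" "y \<in> U" and c: "c \<in> carrier (sec (godement_quotient X P) U)"
  obtain \<sigma> where \<sigma>: "\<sigma> \<in> carrier (sec (C0 X P) U)"
    "c = C0_unit X P U ` carrier (sec P U) +>\<^bsub>sec (C0 X P) U\<^esub> \<sigma>"
    using c unfolding coker_presheaf_simps carrier_quot_module by blast
  obtain V where V: "openin X V" "y \<in> V" "V \<subseteq> U"
    "\<forall>z\<in>V - {y}. carrier (stalk X P z) = {\<zero>\<^bsub>stalk X P z\<^esub>}"
    using near[OF U] by (elim exE conjE)
  \<comment> \<open>The candidate section represents the single germ \<open>\<sigma> y\<close>. It
    is taken over a neighbourhood inside \<open>V\<close>, so that at every other point there is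
    only one germ to choose from.\<close>
  have "\<sigma> y \<in> carrier (stalk X P y)" using \<sigma>(1) U(2) by auto
  then obtain W s where W: "openin X W" "y \<in> W" "W \<subseteq> V" "s \<in> carrier (sec P W)"
    "\<sigma> y = germ X P y W s" using stalk_germ_within[OF P _ V(1,2)] by metis
  have WU: "W \<subseteq> U" using W(3) V(3) by simp
  have "\<sigma> z = germ X P z W s" if z: "z \<in> W" for z
  proof (cases "z = y")
    case False
    have "\<sigma> z \<in> carrier (stalk X P z)" using \<sigma>(1) z WU by auto
    moreover have "germ X P z W s \<in> carrier (stalk X P z)" by (rule germ_in_stalk[OF W(1) z W(4)])
    moreover have "carrier (stalk X P z) = {\<zero>\<^bsub>stalk X P z\<^esub>}" using V(4) z W(3) False by blast
    ultimately show ?thesis by simp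
  qed (use W(5) in simp)
  then have eq: "restrict \<sigma> W = C0_unit X P W s" by (simp add: C0_unit_def cong: restrict_cong)
  \<comment> \<open>The restricted family is the unit of \<open>s\<close>, hence lies in the
    submodule that is divided out, and its coset is zero.\<close>
  have "C0_unit X P W ` carrier (sec P W) +>\<^bsub>sec (C0 X P) W\<^esub> C0_unit X P W s =
      C0_unit X P W ` carrier (sec P W)"
    unfolding rcos_eq_zero_iff[OF presheaf_sec[OF C W(1)] submod_coker[OF P C u W(1)]
        coeff_homD(1)[OF C0_unit_coeff_hom[OF P W(1)] W(4)]]
    using W(4) by (rule imageI)
  then have "restr (godement_quotient X P) U W c = \<zero>\<^bsub>sec (godement_quotient X P) W\<^esub>"
    unfolding \<sigma>(2) coker_restr_rcos[OF P C u U(1) W(1) WU \<sigma>(1)]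
    by (simp add: coker_presheaf_simps eq)
  then show "\<exists>W. openin X W \<and> y \<in> W \<and> W \<subseteq> U \<and>
      restr (godement_quotient X P) U W c = \<zero>\<^bsub>sec (godement_quotient X P) W\<^esub>"
    using W(1,2) WU by blast
qed

section \<open>The Godement resolution\<close>

lemma rep_in: "x \<in> A \<Longrightarrow> rep A \<in> A"
  unfolding rep_def by (rule someI)

text \<open>Elements of a stalk are nonempty classes, so the chosen pair lies in the class and gives
  the germ back.\<close>

lemma stalk_repD:
  assumes P: "presheaf K X P" and a: "a \<in> carrier (stalk X P y)" and r: "rep a = (V, t)"
  shows "openin X V" "y \<in> V" "t \<in> carrier (sec P V)" "germ X P y V t = a"
proof -
  obtain U s where U: "openin X U" "y \<in> U" "s \<in> carrier (sec P U)" "a = germ X P y U s"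
    using a by (auto simp: carrier_stalk)
  have "(V, t) \<in> germ X P y U s"
    using rep_in[OF germ_self[OF P U(1-3)]] r U(4) by simp
  from germ_memD[OF P this] show "openin X V" "y \<in> V" "t \<in> carrier (sec P V)" "germ X P y V t = a"
    using U(4) by auto
qed

lemma stalk_eq_if_rep_eq:
  assumes "presheaf K X P" "a \<in> carrier (stalk X P y)" "b \<in> carrier (stalk X P y)" "rep a = rep b"
  shows "a = b"
  using stalk_repD(4)[OF assms(1,2)] stalk_repD(4)[OF assms(1,3)] assms(4) by (metis surj_pair)

text \<open>The code is read back from the inside out. The stored representatives determine the
  germs of the family \<open>rep c\<close>; this family determines its coset \<open>c\<close>; and
  \<open>V\<close> together with \<open>c\<close> determines the germ
  \<open>\<sigma> y\<close>.\<close>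

lemma inj_god_encode:
  assumes P: "presheaf K X P"
  shows "\<forall>U. openin X U \<longrightarrow>
    inj_on god_encode (carrier (sec (coker_sheaf X P (C0 X P) (C0_unit X P)) U))"
proof (intro allI impI inj_onI)
  let ?Q = "godement_quotient X P"
  note C = presheaf_C0[OF P] and u = C0_unit_morphism[OF P] and Q = presheaf_godement_quotient[OF P]
  fix U \<sigma> \<tau>
  assume U: "openin X U"
    and "\<sigma> \<in> carrier (sec (coker_sheaf X P (C0 X P) (C0_unit X P)) U)"
    and "\<tau> \<in> carrier (sec (coker_sheaf X P (C0 X P) (C0_unit X P)) U)"
    and eq: "god_encode \<sigma> = god_encode \<tau>"
  then have \<sigma>: "\<sigma> \<in> (\<Pi>\<^sub>E y\<in>U. carrier (stalk X ?Q y))" and \<tau>: "\<tau> \<in> (\<Pi>\<^sub>E y\<in>U. carrier (stalk X ?Q y))"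
    by (simp_all add: coker_sheaf_def carrier_sheafify)
  have coset: "rep c \<in> carrier (sec (C0 X P) V) \<and>
      C0_unit X P V ` carrier (sec P V) +>\<^bsub>sec (C0 X P) V\<^esub> rep c = c"
    if V: "openin X V" and c: "c \<in> carrier (sec ?Q V)" for V c
  proof -
    note q = presheaf_sec[OF C V] submod_coker[OF P C u V]
    obtain x where x: "x \<in> carrier (sec (C0 X P) V)"
      "c = C0_unit X P V ` carrier (sec P V) +>\<^bsub>sec (C0 X P) V\<^esub> x"
      using c unfolding coker_presheaf_simps carrier_quot_module by blast
    have "rep c \<in> c" unfolding x(2) by (rule rep_in[OF rcos_self[OF q x(1)]])
    then show ?thesis using rcos_memD[OF q x(1)] x(2) by metis
  qed
  show "\<sigma> = \<tau>"
  proof (rule PiE_ext[OF \<sigma> \<tau>])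
    fix y assume y: "y \<in> U"
    obtain V c where c: "rep (\<sigma> y) = (V, c)" by fastforce
    obtain V' c' where c': "rep (\<tau> y) = (V', c')" by fastforce
    note D = stalk_repD[OF Q PiE_mem[OF \<sigma> y] c] and D' = stalk_repD[OF Q PiE_mem[OF \<tau> y] c']
    have "(case rep (\<sigma> y) of (U, c) \<Rightarrow> (U, \<lambda>x. rep (rep c x))) =
        (case rep (\<tau> y) of (U, c) \<Rightarrow> (U, \<lambda>x. rep (rep c x)))"
      using eq unfolding god_encode_def god.inject by (rule fun_cong)
    \<comment> \<open>The open set is kept in the code, so both cosets live over one
      \<open>V\<close> and the families \<open>rep c\<close> and \<open>rep c'\<close> are
      extensional on the same set.\<close>
    then have V: "V' = V" and r: "\<And>x. rep (rep c x) = rep (rep c' x)"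
      unfolding c c' by (auto dest: fun_cong)
    note cs = coset[OF D(1,3)] and cs' = coset[OF D'(1,3), unfolded V]
    have "rep c = rep c'"
    proof (rule PiE_ext)
      show "rep c \<in> (\<Pi>\<^sub>E x\<in>V. carrier (stalk X P x))" "rep c' \<in> (\<Pi>\<^sub>E x\<in>V. carrier (stalk X P x))"
        using cs cs' by simp_all
      then show "rep c x = rep c' x" if "x \<in> V" for x
        using that by (intro stalk_eq_if_rep_eq[OF P _ _ r]) (rule PiE_mem; assumption)+
    qed
    then have "c = c'" using cs cs' by metis
    then show "\<sigma> y = \<tau> y" using D(4) D'(4) V by simp
  qed
qed

lemma inj_Base: "\<forall>U. openin X U \<longrightarrow> inj_on Base (carrier (sec F U))"
  by (simp add: inj_on_def)

section \<open>The terms and differentials of the resolution\<close>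

lemma presheaf_coker_sheaf_godement:
  "presheaf K X P \<Longrightarrow> presheaf K X (coker_sheaf X P (C0 X P) (C0_unit X P))"
  unfolding coker_sheaf_def by (intro presheaf_sheafify presheaf_godement_quotient)

lemma presheaf_god_sheaf:
  assumes F: "presheaf K X F"
  shows "presheaf K X (god_sheaf X F n)"
proof (induction n)
  case 0
  show ?case by (simp add: presheaf_transport[OF F inj_Base])
next
  case (Suc n)
  show ?case
    by (simp add: presheaf_transport[OF presheaf_coker_sheaf_godement[OF Suc] inj_god_encode[OF Suc]])
qed

lemma presheaf_god_C: "presheaf K X F \<Longrightarrow> presheaf K X (god_C X F n)"
  unfolding god_C_def by (intro presheaf_C0 presheaf_god_sheaf)

lemma god_d_coeff_hom:
  assumes F: "presheaf K X F" and U: "openin X U"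
  shows "god_d X F n U \<in> coeff_hom K (sec (god_C X F n) U) (sec (god_C X F (Suc n)) U)"
proof -
  note P = presheaf_god_sheaf[OF F, of n]
  have "god_encode \<in> coeff_hom K (sec (coker_sheaf X (god_sheaf X F n) (god_C X F n)
      (C0_unit X (god_sheaf X F n))) U) (sec (god_sheaf X F (Suc n)) U)"
    using transport_coeff_hom[OF presheaf_coker_sheaf_godement[OF P] inj_god_encode[OF P] U]
    by (simp add: god_C_def)
  from coeff_hom_comp[OF coeff_hom_comp[OF
        sheaf_morphism_hom[OF coker_proj_morphism[OF P presheaf_C0[OF P] C0_unit_morphism[OF P]] U,
          folded god_C_def] this]
      C0_unit_coeff_hom[OF presheaf_god_sheaf[OF F, of "Suc n"] U, folded god_C_def]]
  show ?thesis unfolding god_d_def[abs_def] .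
qed

text \<open>One degree of the resolution is passed as follows: the quotient presheaf has zero stalk
  at \<open>y\<close> by the condition on punctured neighbourhoods, and sheafifying and transporting
  both preserve this.\<close>

lemma stalk_trivial_god_sheaf_Suc:
  assumes F: "presheaf K X F" and y: "y \<in> topspace X"
    and near: "\<And>W. openin X W \<Longrightarrow> y \<in> W \<Longrightarrow> \<exists>V. openin X V \<and> y \<in> V \<and> V \<subseteq> W \<and>
      (\<forall>z\<in>V - {y}. carrier (stalk X (god_sheaf X F n) z) = {\<zero>\<^bsub>stalk X (god_sheaf X F n) z\<^esub>})"
  shows "carrier (stalk X (god_sheaf X F (Suc n)) y) = {\<zero>\<^bsub>stalk X (god_sheaf X F (Suc n)) y\<^esub>}"
proof -
  note P = presheaf_god_sheaf[OF F, of n]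
  have "carrier (stalk X (godement_quotient X (god_sheaf X F n)) y) =
      {\<zero>\<^bsub>stalk X (godement_quotient X (god_sheaf X F n)) y\<^esub>}"
    by (rule stalk_trivial_godement_quotient[OF P y near])
  from stalk_trivial_sheafify[OF presheaf_godement_quotient[OF P] y this]
  show ?thesis
    using stalk_trivial_transport[OF presheaf_coker_sheaf_godement[OF P] inj_god_encode[OF P] y]
    by (simp add: coker_sheaf_def)
qed

subsection \<open>Functoriality\<close>

context
  fixes K :: "'r ring option" and X :: "'p topology"
    and F :: "('p, 'r, 'a) presheaf" and G :: "('p, 'r, 'b) presheaf" and \<phi>
  assumes F: "presheaf K X F" and G: "presheaf K X G" and \<phi>: "sheaf_morphism K X F G \<phi>"
begin

text \<open>Naturality of the unit gives a commutative square between the degree \<open>n\<close>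
  sheaves and their germ families. It induces a map of quotient presheaves, which is then sheafified
  and transported to degree \<open>Suc n\<close>.\<close>

lemma god_sheaf_map_morphism:
  "sheaf_morphism K X (god_sheaf X F n) (god_sheaf X G n) (god_sheaf_map X F G \<phi> n)"
proof (induction n)
  case 0
  show ?case by (simp add: transport_map_morphism[OF F inj_Base G inj_Base \<phi>])
next
  case (Suc n)
  note P = presheaf_god_sheaf[OF F, of n] and P' = presheaf_god_sheaf[OF G, of n]
  have comm: "\<forall>U s. openin X U \<longrightarrow> s \<in> carrier (sec (god_sheaf X F n) U) \<longrightarrow>
      C0_map X (god_sheaf X G n) (god_sheaf_map X F G \<phi> n) U (C0_unit X (god_sheaf X F n) U s) =
      C0_unit X (god_sheaf X G n) U (god_sheaf_map X F G \<phi> n U s)"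
    using C0_map_unit[OF P P' Suc] by blast
  note q = coker_map_morphism[OF P presheaf_C0[OF P] C0_unit_morphism[OF P]
      P' presheaf_C0[OF P'] C0_unit_morphism[OF P'] Suc C0_map_morphism[OF P P' Suc], OF comm]
  have "sheaf_morphism K X
      (coker_sheaf X (god_sheaf X F n) (C0 X (god_sheaf X F n)) (C0_unit X (god_sheaf X F n)))
      (coker_sheaf X (god_sheaf X G n) (C0 X (god_sheaf X G n)) (C0_unit X (god_sheaf X G n)))
      (C0_map X (godement_quotient X (god_sheaf X G n))
        (\<lambda>U. quot_map (sec (C0 X (god_sheaf X G n)) U)
            (C0_unit X (god_sheaf X G n) U ` carrier (sec (god_sheaf X G n) U))
            (C0_map X (god_sheaf X G n) (god_sheaf_map X F G \<phi> n) U)))"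
    unfolding coker_sheaf_def
    by (rule C0_map_sheafify_morphism[OF presheaf_godement_quotient[OF P]
          presheaf_godement_quotient[OF P'] q])
  from transport_map_morphism[OF presheaf_coker_sheaf_godement[OF P] inj_god_encode[OF P]
      presheaf_coker_sheaf_godement[OF P'] inj_god_encode[OF P'] this]
  show ?case by simp
qed

text \<open>The differential is the projection to the cokernel sheaf, then the encoding, then the
  unit. The square is pasted from one square for each: \<open>coker_proj_natural\<close>,
  \<open>transport_map_apply\<close> and \<open>C0_map_unit\<close>.\<close>

lemma god_d_natural:
  assumes U: "openin X U" and \<sigma>: "\<sigma> \<in> carrier (sec (god_C X F n) U)"
  shows "god_d X G n U (C0_map X (god_sheaf X G n) (god_sheaf_map X F G \<phi> n) U \<sigma>) =
    C0_map X (god_sheaf X G (Suc n)) (god_sheaf_map X F G \<phi> (Suc n)) U (god_d X F n U \<sigma>)"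
proof -
  note P = presheaf_god_sheaf[OF F, of n] and P' = presheaf_god_sheaf[OF G, of n]
  note m = god_sheaf_map_morphism[of n]
  let ?p = "coker_proj X (god_sheaf X F n) (god_C X F n) (C0_unit X (god_sheaf X F n)) U \<sigma>"
  have comm: "\<forall>U s. openin X U \<longrightarrow> s \<in> carrier (sec (god_sheaf X F n) U) \<longrightarrow>
      C0_map X (god_sheaf X G n) (god_sheaf_map X F G \<phi> n) U (C0_unit X (god_sheaf X F n) U s) =
      C0_unit X (god_sheaf X G n) U (god_sheaf_map X F G \<phi> n U s)"
    using C0_map_unit[OF P P' m] by blast
  have \<sigma>': "\<sigma> \<in> carrier (sec (C0 X (god_sheaf X F n)) U)" using \<sigma> by (simp only: god_C_def)
  have p: "?p \<in> carrier (sec (coker_sheaf X (god_sheaf X F n) (C0 X (god_sheaf X F n))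
      (C0_unit X (god_sheaf X F n))) U)"
    unfolding god_C_def
    by (rule coeff_homD(1)[OF sheaf_morphism_hom[OF
            coker_proj_morphism[OF P presheaf_C0[OF P] C0_unit_morphism[OF P]] U] \<sigma>'])
  have enc: "god_encode ?p \<in> carrier (sec (god_sheaf X F (Suc n)) U)"
    using p by (simp add: carrier_transport)
  have "god_sheaf_map X F G \<phi> (Suc n) U (god_encode ?p) =
      god_encode (coker_proj X (god_sheaf X G n) (god_C X G n) (C0_unit X (god_sheaf X G n)) U
        (C0_map X (god_sheaf X G n) (god_sheaf_map X F G \<phi> n) U \<sigma>))"
    unfolding god_sheaf_map.simps
      transport_map_apply[OF presheaf_coker_sheaf_godement[OF P] inj_god_encode[OF P] U p]
    unfolding god_C_def
    unfolding coker_proj_natural[OF P presheaf_C0[OF P] C0_unit_morphism[OF P]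
          P' presheaf_C0[OF P'] C0_unit_morphism[OF P'] m C0_map_morphism[OF P P' m] comm U \<sigma>'] ..
  then show ?thesis
    unfolding god_d_def
    using C0_map_unit[OF presheaf_god_sheaf[OF F] presheaf_god_sheaf[OF G]
        god_sheaf_map_morphism U enc] by simp
qed

lemma god_global_map_coeff_hom:
  "god_global_map X F G \<phi> n \<in> coeff_hom K (god_global X F n) (god_global X G n)"
  unfolding god_global_map_def god_global_def god_C_def
  by (rule C0_map_coeff_hom[OF presheaf_god_sheaf[OF F] presheaf_god_sheaf[OF G]
        god_sheaf_map_morphism]) simp

lemma god_delta_natural:
  "x \<in> carrier (god_global X F n) \<Longrightarrow>
     god_delta X G n (god_global_map X F G \<phi> n x) = god_global_map X F G \<phi> (Suc n) (god_delta X F n x)"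
  unfolding god_global_def god_global_map_def god_delta_def by (rule god_d_natural) simp_all

end

subsection \<open>Cohomology\<close>

text \<open>Cosets depend on the addition only. Hence classes in the module of cocycles are
  literally cosets formed among all global sections, and the two descriptions can be exchanged by
  rewriting.\<close>

lemma a_r_coset_carrier_update [simp]: "B +>\<^bsub>M\<lparr>carrier := Z\<rparr>\<^esub> x = B +>\<^bsub>M\<^esub> x"
  by (simp add: a_r_coset_def')

lemma quot_map_carrier_update [simp]: "quot_map (M\<lparr>carrier := Z\<rparr>) B = quot_map M B"
  by (simp add: quot_map_def fun_eq_iff)

lemma coeff_object_god_global: "presheaf K X F \<Longrightarrow> coeff_object K (god_global X F n)"
  unfolding god_global_def by (rule presheaf_sec[OF presheaf_god_C]) simp_all

lemma god_delta_coeff_hom: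
  "presheaf K X F \<Longrightarrow> god_delta X F n \<in> coeff_hom K (god_global X F n) (god_global X F (Suc n))"
  unfolding god_global_def god_delta_def by (rule god_d_coeff_hom) simp_all

lemma submod_god_cocycles: "presheaf K X F \<Longrightarrow> submod K (god_global X F n) (god_cocycles X F n)"
  unfolding god_cocycles_def
  by (intro submod_kernel coeff_object_god_global god_delta_coeff_hom)

lemma submod_god_coboundaries:
  "presheaf K X F \<Longrightarrow> submod K (god_global X F n) (god_coboundaries X F n)"
  by (cases n) (auto simp: god_coboundaries_def
      intro!: submod_zero submod_image coeff_object_god_global god_delta_coeff_hom)

lemma rcos_zero_singleton:
  assumes "coeff_object K M" "x \<in> carrier M"
  shows "{\<zero>\<^bsub>M\<^esub>} +>\<^bsub>M\<^esub> x = {x}"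
  using coeff_object_abelian_group[OF assms(1)] assms(2)
  by (simp add: a_r_coset_def' abelian_group_def abelian_monoid.l_zero)

text \<open>Modulo the zero submodule every coset is a singleton, so the first quotient is a copy of
  the kernel with \<open>the_elem\<close> as its inclusion. At the other end, a coset is zero
  exactly for elements of the image.\<close>

lemma exact4_kernel_cokernel:
  assumes M: "coeff_object K M" and N: "coeff_object K N" and d: "d \<in> coeff_hom K M N"
  shows "exact4 K (quot_module (M\<lparr>carrier := a_kernel M N d\<rparr>) {\<zero>\<^bsub>M\<^esub>}) the_elem M d N
    (\<lambda>x. d ` carrier M +>\<^bsub>N\<^esub> x) (quot_module N (d ` carrier M))"
proof -
  let ?Z = "M\<lparr>carrier := a_kernel M N d\<rparr>"
  note k = submod_kernel[OF M N d] and i = submod_image[OF M N d]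
  have Z: "coeff_object K ?Z" by (rule coeff_object_submod[OF M k])
  have z: "submod K ?Z {\<zero>\<^bsub>M\<^esub>}"
    by (rule submod_restrict[OF M k submod_zero[OF M]]) (use k in \<open>auto simp: submod_def\<close>)
  have sing: "{\<zero>\<^bsub>M\<^esub>} +>\<^bsub>M\<^esub> x = {x}" if "x \<in> a_kernel M N d" for x
    using rcos_zero_singleton[OF M] that by (simp add: a_kernel_def')
  have car: "carrier (quot_module ?Z {\<zero>\<^bsub>M\<^esub>}) = (\<lambda>x. {x}) ` a_kernel M N d"
    unfolding carrier_quot_module using sing by auto
  have zk: "\<zero>\<^bsub>M\<^esub> \<in> a_kernel M N d" using k by (simp add: submod_def)
  have "the_elem \<in> coeff_hom K (quot_module ?Z {\<zero>\<^bsub>M\<^esub>}) M"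
  proof (rule coeff_hom_factor[OF Z rcos_coeff_hom[OF Z z] carrier_quot_module])
    show "(\<lambda>a. the_elem ({\<zero>\<^bsub>M\<^esub>} +>\<^bsub>?Z\<^esub> a)) \<in> coeff_hom K ?Z M"
      by (rule coeff_hom_cong[OF Z, of _ "\<lambda>x. x"]) (auto simp: sing coeff_hom_iff a_kernel_def')
  qed
  moreover have "a_kernel (quot_module ?Z {\<zero>\<^bsub>M\<^esub>}) M the_elem = {{\<zero>\<^bsub>M\<^esub>}}"
    unfolding a_kernel_def'[of "quot_module ?Z {\<zero>\<^bsub>M\<^esub>}"] car using zk by auto
  moreover have "a_kernel N (quot_module N (d ` carrier M)) (\<lambda>x. d ` carrier M +>\<^bsub>N\<^esub> x) = d ` carrier M"
    using rcos_eq_zero_iff[OF N i] i by (auto simp: a_kernel_def' submod_def)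
  ultimately show ?thesis
    unfolding exact4_def
    using M N d coeff_object_quot_module[OF Z z] coeff_object_quot_module[OF N i] rcos_coeff_hom[OF N i]
    by (simp add: car image_image) (simp add: carrier_quot_module)
qed

text \<open>A differential ends with the unit of the next sheaf, and the following one begins by
  dividing out the image of that very unit. The class is thus zero already in the quotient presheaf,
  and the remaining maps preserve zero.\<close>

lemma god_delta_delta:
  assumes F: "presheaf K X F" and x: "x \<in> carrier (god_global X F n)"
  shows "god_delta X F (Suc n) (god_delta X F n x) = \<zero>\<^bsub>god_global X F (Suc (Suc n))\<^esub>"
proof -
  let ?U = "topspace X" and ?P = "god_sheaf X F (Suc n)"
  let ?N = "C0_unit X ?P ?U ` carrier (sec ?P ?U)"
  have U: "openin X ?U" by simp
  note P = presheaf_god_sheaf[OF F, of "Suc n"] and P' = presheaf_god_sheaf[OF F, of "Suc (Suc n)"]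
  note Q = presheaf_godement_quotient[OF P] and S = presheaf_coker_sheaf_godement[OF P]
  \<comment> \<open>\<open>t\<close> is the global section of the sheaf in degree
    \<open>Suc n\<close> through which the first differential factors.\<close>
  define t where
    "t = god_encode (coker_proj X (god_sheaf X F n) (god_C X F n) (C0_unit X (god_sheaf X F n)) ?U x)"
  have "coker_proj X (god_sheaf X F n) (god_C X F n) (C0_unit X (god_sheaf X F n)) ?U x \<in>
      carrier (sec (coker_sheaf X (god_sheaf X F n) (C0 X (god_sheaf X F n))
        (C0_unit X (god_sheaf X F n))) ?U)"
    using coeff_homD(1)[OF sheaf_morphism_hom[OF coker_proj_morphism[OF presheaf_god_sheaf[OF F]
            presheaf_C0[OF presheaf_god_sheaf[OF F]] C0_unit_morphism[OF presheaf_god_sheaf[OF F]]] U]]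
      x unfolding god_global_def god_C_def by blast
  then have t: "t \<in> carrier (sec ?P ?U)" by (simp add: t_def carrier_transport)
  have d: "god_delta X F n x = C0_unit X ?P ?U t" by (simp only: god_delta_def god_d_def t_def)
  have "?N +>\<^bsub>sec (C0 X ?P) ?U\<^esub> C0_unit X ?P ?U t = \<zero>\<^bsub>sec (godement_quotient X ?P) ?U\<^esub>"
    unfolding coker_presheaf_simps zero_quot_module
    using rcos_eq_zero_iff[OF presheaf_sec[OF presheaf_C0[OF P] U]
        submod_coker[OF P presheaf_C0[OF P] C0_unit_morphism[OF P] U]
        coeff_homD(1)[OF C0_unit_coeff_hom[OF P U] t]] t by blast
  then have "god_delta X F (Suc n) (god_delta X F n x) =
      C0_unit X (god_sheaf X F (Suc (Suc n))) ?U (god_encode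
        (C0_unit X (godement_quotient X ?P) ?U \<zero>\<^bsub>sec (godement_quotient X ?P) ?U\<^esub>))"
    unfolding d unfolding god_delta_def god_d_def[of X F "Suc n"] coker_proj_def god_C_def
    by (simp only:)
  also have "C0_unit X (godement_quotient X ?P) ?U \<zero>\<^bsub>sec (godement_quotient X ?P) ?U\<^esub> =
      \<zero>\<^bsub>sec (coker_sheaf X ?P (C0 X ?P) (C0_unit X ?P)) ?U\<^esub>"
    by (rule coeff_hom_zero[OF presheaf_sec[OF Q U] presheaf_sec[OF S U]
          sheaf_morphism_hom[OF C0_unit_sheafify_morphism[OF Q, folded coker_sheaf_def] U]])
  also have "god_encode \<dots> = \<zero>\<^bsub>sec (god_sheaf X F (Suc (Suc n))) ?U\<^esub>"
    by (simp only: god_sheaf.simps zero_transport)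
  also have "C0_unit X (god_sheaf X F (Suc (Suc n))) ?U \<dots> = \<zero>\<^bsub>god_global X F (Suc (Suc n))\<^esub>"
    unfolding god_global_def god_C_def
    by (rule coeff_hom_zero[OF presheaf_sec[OF P' U] presheaf_sec[OF presheaf_C0[OF P'] U]
          C0_unit_coeff_hom[OF P' U]])
  finally show ?thesis .
qed

lemma god_coboundaries_subset_cocycles:
  assumes F: "presheaf K X F"
  shows "god_coboundaries X F n \<subseteq> god_cocycles X F n"
proof (cases n)
  case 0
  then show ?thesis using submod_god_cocycles[OF F, of n] by (simp add: god_coboundaries_def submod_def)
next
  case (Suc m)
  then show ?thesis
    using god_delta_delta[OF F] coeff_homD(1)[OF god_delta_coeff_hom[OF F]]
    by (auto simp: god_coboundaries_def god_cocycles_def a_kernel_def')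
qed

text \<open>Cocycles and coboundaries are submodules of a zero module, so both are zero and a single
  coset remains.\<close>

lemma sheaf_cohom_trivial:
  assumes F: "presheaf K X F" and triv: "carrier (god_global X F n) = {\<zero>\<^bsub>god_global X F n\<^esub>}"
  shows "carrier (sheaf_cohom X F n) = {\<zero>\<^bsub>sheaf_cohom X F n\<^esub>}"
proof -
  note M = coeff_object_god_global[OF F, of n]
  have "god_coboundaries X F n = {\<zero>\<^bsub>god_global X F n\<^esub>}" "god_cocycles X F n = {\<zero>\<^bsub>god_global X F n\<^esub>}"
    using submod_god_coboundaries[OF F, of n] submod_god_cocycles[OF F, of n] triv
    unfolding submod_def by auto
  then show ?thesis
    using rcos_zero[OF M submod_zero[OF M]] by (simp add: sheaf_cohom_def carrier_quot_module)
qed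

lemma submod_coboundaries_in_cocycles:
  assumes F: "presheaf K X F"
  shows "submod K ((god_global X F n)\<lparr>carrier := god_cocycles X F n\<rparr>) (god_coboundaries X F n)"
  by (rule submod_restrict[OF coeff_object_god_global[OF F] submod_god_cocycles[OF F]
        submod_god_coboundaries[OF F] god_coboundaries_subset_cocycles[OF F]])

section \<open>Maps induced on cohomology\<close>

context
  fixes K :: "'r ring option" and X :: "'p topology"
    and F :: "('p, 'r, 'a) presheaf" and G :: "('p, 'r, 'b) presheaf" and \<phi>
  assumes F: "presheaf K X F" and G: "presheaf K X G" and \<phi>: "sheaf_morphism K X F G \<phi>"
begin

lemma god_global_map_zero:
  "god_global_map X F G \<phi> n \<zero>\<^bsub>god_global X F n\<^esub> = \<zero>\<^bsub>god_global X G n\<^esub>"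
  by (rule coeff_hom_zero[OF coeff_object_god_global[OF F] coeff_object_god_global[OF G]
        god_global_map_coeff_hom[OF F G \<phi>]])

lemma god_global_map_coboundaries:
  "god_global_map X F G \<phi> n ` god_coboundaries X F n \<subseteq> god_coboundaries X G n"
proof (cases n)
  case 0
  then show ?thesis using god_global_map_zero[of n] by (simp add: god_coboundaries_def)
next
  case (Suc m)
  then show ?thesis
    using god_delta_natural[OF F G \<phi>, of _ m, symmetric]
      coeff_homD(1)[OF god_global_map_coeff_hom[OF F G \<phi>, of m]]
    by (auto simp: god_coboundaries_def)
qed

lemma god_global_map_cocycles:
  "x \<in> god_cocycles X F n \<Longrightarrow> god_global_map X F G \<phi> n x \<in> god_cocycles X G n"
  using god_delta_natural[OF F G \<phi>, of x n] god_global_map_zero[of "Suc n"]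
    coeff_homD(1)[OF god_global_map_coeff_hom[OF F G \<phi>, of n]]
  by (simp add: god_cocycles_def a_kernel_def')

text \<open>\<open>sheaf_cohom_map\<close> is built from the module of all global sections, so the
  rule holds for any such \<open>x\<close> and not just for cocycles. In degree one it is the
  naturality of \<open>cohom1_proj\<close>.\<close>

lemma sheaf_cohom_map_rcos:
  "x \<in> carrier (god_global X F n) \<Longrightarrow>
     sheaf_cohom_map X F G \<phi> n (god_coboundaries X F n +>\<^bsub>god_global X F n\<^esub> x) =
       god_coboundaries X G n +>\<^bsub>god_global X G n\<^esub> god_global_map X F G \<phi> n x"
  unfolding sheaf_cohom_map_def
  by (rule quot_map_rcos[OF coeff_object_god_global[OF F] submod_god_coboundaries[OF F]
        coeff_object_god_global[OF G] submod_god_coboundaries[OF G]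
        god_global_map_coeff_hom[OF F G \<phi>] god_global_map_coboundaries])

lemma sheaf_cohom_map_coeff_hom:
  "sheaf_cohom_map X F G \<phi> n \<in> coeff_hom K (sheaf_cohom X F n) (sheaf_cohom X G n)"
proof -
  let ?Z = "(god_global X F n)\<lparr>carrier := god_cocycles X F n\<rparr>"
  let ?Z' = "(god_global X G n)\<lparr>carrier := god_cocycles X G n\<rparr>"
  have "x \<in> carrier (god_global X F n)" if "x \<in> god_cocycles X F n" for x
    using that by (simp add: god_cocycles_def a_kernel_def')
  then have "god_global_map X F G \<phi> n \<in> coeff_hom K ?Z ?Z'"
    using god_global_map_coeff_hom[OF F G \<phi>, of n] god_global_map_cocycles
    by (auto simp: coeff_hom_iff)
  from quot_map_coeff_hom[OF coeff_object_submod[OF coeff_object_god_global[OF F] submod_god_cocycles[OF F]]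
      submod_coboundaries_in_cocycles[OF F]
      coeff_object_submod[OF coeff_object_god_global[OF G] submod_god_cocycles[OF G]]
      submod_coboundaries_in_cocycles[OF G] this god_global_map_coboundaries]
  show ?thesis by (simp add: sheaf_cohom_map_def sheaf_cohom_def)
qed

text \<open>In degree 0 the coboundaries are zero, so classes are singletons and
  \<open>the_elem\<close> undoes the passage to cosets on both sides of the square.\<close>

lemma cohom0_incl_natural:
  assumes "c \<in> carrier (sheaf_cohom X F 0)"
  shows "cohom0_incl (sheaf_cohom_map X F G \<phi> 0 c) = god_global_map X F G \<phi> 0 (cohom0_incl c)"
proof -
  obtain x where x: "x \<in> carrier (god_global X F 0)"
    "c = god_coboundaries X F 0 +>\<^bsub>god_global X F 0\<^esub> x"
    using assms by (auto simp: sheaf_cohom_def carrier_quot_module god_cocycles_def a_kernel_def')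
  have fx: "god_global_map X F G \<phi> 0 x \<in> carrier (god_global X G 0)"
    by (rule coeff_homD(1)[OF god_global_map_coeff_hom[OF F G \<phi>] x(1)])
  show ?thesis
    unfolding x(2) sheaf_cohom_map_rcos[OF x(1)]
    by (simp add: god_coboundaries_def cohom0_incl_def
        rcos_zero_singleton[OF coeff_object_god_global[OF F] x(1)]
        rcos_zero_singleton[OF coeff_object_god_global[OF G] fx])
qed

end

section \<open>GKM-hypergraphs\<close>

text \<open>The space is the union of its generating sets. A set \<open>U_e\<close> consists of its
  hyperedge and of vertices, which are open points themselves, so every point owns a basic open set
  with no hyperedge other than possibly the point.\<close>

lemma gkm_top_points:
  assumes \<Gamma>: "gkm_hypergraph T \<tau> \<Gamma>" and y: "y \<in> topspace (gkm_top T \<tau> \<Gamma>)"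
  obtains v where "y = Inl v" "openin (gkm_top T \<tau> \<Gamma>) {Inl v}"
  | e where "y = Inr e" "openin (gkm_top T \<tau> \<Gamma>) (insert (Inr e) (Inl ` fst e))"
proof -
  have op: "openin (gkm_top T \<tau> \<Gamma>) {Inl v}" if "v \<in> verts \<Gamma>" for v
    unfolding gkm_top_def using that by (intro topology_generated_by_Basis) auto
  have op': "openin (gkm_top T \<tau> \<Gamma>) (insert (Inr e) (Inl ` fst e))" if "e \<in> hyperedges T \<tau> \<Gamma>" for e
    unfolding gkm_top_def using that by (intro topology_generated_by_Basis) blast
  have sub: "fst e \<subseteq> verts \<Gamma>" if "e \<in> hyperedges T \<tau> \<Gamma>" for e
    using that \<Gamma> in_quotient_imp_subset by (fastforce simp: hyperedges_def gkm_hypergraph_def)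
  consider v where "v \<in> verts \<Gamma>" "y = Inl v"
    | e where "e \<in> hyperedges T \<tau> \<Gamma>" "y \<in> insert (Inr e) (Inl ` fst e)"
    using y unfolding gkm_top_def topology_generated_by_topspace by blast
  then show thesis
    using that op op' sub by cases blast+
qed

lemma god_C_trivial:
  assumes "\<And>y. y \<in> topspace X \<Longrightarrow>
    carrier (stalk X (god_sheaf X F n) y) = {\<zero>\<^bsub>stalk X (god_sheaf X F n) y\<^esub>}"
  shows "carrier (god_global X F n) = {\<zero>\<^bsub>god_global X F n\<^esub>}"
  unfolding god_global_def god_C_def C0_simps PiE_eq_singleton using assms by blast

text \<open>The bound 2 counts the two layers of points. From there on every stalk is zero, so the
  condition near a point holds for any neighbourhood, and induction gives all later degrees.\<close>

lemma gkm_stalk_trivial: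
  assumes \<Gamma>: "gkm_hypergraph T \<tau> \<Gamma>" and X: "X = gkm_top T \<tau> \<Gamma>" and F: "presheaf K X F"
    and n: "n \<ge> 2" and y: "y \<in> topspace X"
  shows "carrier (stalk X (god_sheaf X F n) y) = {\<zero>\<^bsub>stalk X (god_sheaf X F n) y\<^esub>}"
proof -
  let ?triv = "\<lambda>n y. carrier (stalk X (god_sheaf X F n) y) = {\<zero>\<^bsub>stalk X (god_sheaf X F n) y\<^esub>}"
  \<comment> \<open>Removing the point from the open set \<open>{Inl v}\<close> leaves nothing, so
    the condition on degree \<open>m\<close> is vacuous and vertices are cleared in every positive
    degree.\<close>
  have vertex: "?triv (Suc m) (Inl v)" if "openin X {Inl v}" for m v
  proof (rule stalk_trivial_god_sheaf_Suc[OF F])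
    show "Inl v \<in> topspace X" using openin_subset[OF that] by simp
    fix W assume W: "openin X W" "Inl v \<in> W"
    show "\<exists>V. openin X V \<and> Inl v \<in> V \<and> V \<subseteq> W \<and> (\<forall>z\<in>V - {Inl v}. ?triv m z)"
      by (rule exI[of _ "{Inl v}"]) (use that W in auto)
  qed
  have two: "?triv 2 y" if y: "y \<in> topspace X" for y
    unfolding numeral_2_eq_2
  proof (rule stalk_trivial_god_sheaf_Suc[OF F y])
    fix W assume W: "openin X W" "y \<in> W"
    show "\<exists>V. openin X V \<and> y \<in> V \<and> V \<subseteq> W \<and> (\<forall>z\<in>V - {y}. ?triv (Suc 0) z)"
    proof (rule gkm_top_points[OF \<Gamma> y[unfolded X], folded X])
      fix v assume "y = Inl v" "openin X {Inl v}"
      then show ?thesis using W by (intro exI[of _ "{Inl v}"]) auto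
    next
      fix e assume e: "y = Inr e" "openin X (insert (Inr e) (Inl ` fst e))"
      \<comment> \<open>The intersection with the basic set of \<open>e\<close> contains no other
        hyperedge; its remaining points are open vertices, where degree one vanishes
        already.\<close>
      define V where "V = W \<inter> insert (Inr e) (Inl ` fst e)"
      have V: "openin X V" "y \<in> V" "V \<subseteq> W" unfolding V_def using W e by (blast intro: openin_Int)+
      have "?triv (Suc 0) z" if z: "z \<in> V - {y}" for z
      proof -
        have zX: "z \<in> topspace X" using openin_subset[OF V(1)] z by auto
        show ?thesis
        proof (rule gkm_top_points[OF \<Gamma> zX[unfolded X], folded X])
          fix v assume "z = Inl v" "openin X {Inl v}"
          then show ?thesis using vertex by blast
        next
          fix e' assume "z = Inr e'"
          then show ?thesis using z e(1) by (auto simp: V_def)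
        qed
      qed
      then show ?thesis using V by (intro exI[of _ V]) simp
    qed
  qed
  show ?thesis
    using n y
  proof (induction n arbitrary: y rule: dec_induct)
    case base
    then show ?case by (rule two)
  next
    case (step n)
    show ?case
    proof (rule stalk_trivial_god_sheaf_Suc[OF F step.prems])
      fix W assume W: "openin X W" "y \<in> W"
      then show "\<exists>V. openin X V \<and> y \<in> V \<and> V \<subseteq> W \<and> (\<forall>z\<in>V - {y}. ?triv n z)"
        using step.IH openin_subset[OF W(1)] by (intro exI[of _ W]) auto
    qed
  qed
qed

theorem corollary5p2:
  fixes T :: "('t, 'm) monoid_scheme" and \<tau> :: "'t topology"
    and \<Gamma> :: "('v, ('t \<Rightarrow> complex) set) hypergraph"
    and X :: "('v + 'v set \<times> ('t \<Rightarrow> complex) set) topology"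
    and K :: "'r ring option"
    and F :: "('v + 'v set \<times> ('t \<Rightarrow> complex) set, 'r, 'a) presheaf"
  assumes "compact_torus T \<tau>"
    and "gkm_hypergraph T \<tau> \<Gamma>"
    and "X = gkm_top T \<tau> \<Gamma>"
    and "sheaf K X F"
  shows "(\<forall>n\<ge>2. carrier (sheaf_cohom X F n) = {\<zero>\<^bsub>sheaf_cohom X F n\<^esub>}) \<and>
    exact4 K (sheaf_cohom X F 0) cohom0_incl (god_global X F 0) (god_delta X F 0)
      (god_global X F 1) (cohom1_proj X F) (sheaf_cohom X F 1) \<and>
    (\<forall>(G :: ('v + 'v set \<times> ('t \<Rightarrow> complex) set, 'r, 'b) presheaf) \<phi>.
       sheaf K X G \<longrightarrow> sheaf_morphism K X F G \<phi> \<longrightarrow>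
       (\<forall>n\<in>{0, 1}.
          god_global_map X F G \<phi> n \<in> coeff_hom K (god_global X F n) (god_global X G n) \<and>
          sheaf_cohom_map X F G \<phi> n \<in> coeff_hom K (sheaf_cohom X F n) (sheaf_cohom X G n)) \<and>
       (\<forall>c\<in>carrier (sheaf_cohom X F 0).
          cohom0_incl (sheaf_cohom_map X F G \<phi> 0 c) = god_global_map X F G \<phi> 0 (cohom0_incl c)) \<and>
       (\<forall>x\<in>carrier (god_global X F 0).
          god_delta X G 0 (god_global_map X F G \<phi> 0 x) = god_global_map X F G \<phi> 1 (god_delta X F 0 x)) \<and>
       (\<forall>x\<in>carrier (god_global X F 1).
          cohom1_proj X G (god_global_map X F G \<phi> 1 x) = sheaf_cohom_map X F G \<phi> 1 (cohom1_proj X F x)))"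
proof (intro conjI allI impI)
  have F: "presheaf K X F" using assms(4) by (simp add: sheaf_def)
  have triv: "carrier (god_global X F n) = {\<zero>\<^bsub>god_global X F n\<^esub>}" if "n \<ge> 2" for n
    by (rule god_C_trivial[OF gkm_stalk_trivial[OF assms(2,3) F that]])
  show "carrier (sheaf_cohom X F n) = {\<zero>\<^bsub>sheaf_cohom X F n\<^esub>}" if "n \<ge> 2" for n
    by (rule sheaf_cohom_trivial[OF F triv[OF that]])
  note \<delta> = god_delta_coeff_hom[OF F]
  \<comment> \<open>This differential takes values in a zero module, so all global sections in
    degree one are cocycles. That is what makes \<open>cohom1_proj\<close> a map onto the degree one
    cohomology.\<close>
  have "god_delta X F 1 x = \<zero>\<^bsub>god_global X F 2\<^esub>" if "x \<in> carrier (god_global X F 1)" for x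
    using coeff_homD(1)[OF \<delta> that] triv[of 2] by (simp add: numeral_2_eq_2)
  then have "god_cocycles X F 1 = carrier (god_global X F 1)"
    by (auto simp: god_cocycles_def a_kernel_def' numeral_2_eq_2)
  then have H1: "sheaf_cohom X F 1 =
      quot_module (god_global X F 1) (god_delta X F 0 ` carrier (god_global X F 0))"
    by (simp add: sheaf_cohom_def god_coboundaries_def)
  have H0: "sheaf_cohom X F 0 = quot_module ((god_global X F 0)\<lparr>carrier :=
      a_kernel (god_global X F 0) (god_global X F 1) (god_delta X F 0)\<rparr>) {\<zero>\<^bsub>god_global X F 0\<^esub>}"
    by (simp add: sheaf_cohom_def god_coboundaries_def god_cocycles_def)
  \<comment> \<open>After unfolding, the modules and maps of the sequence are literally those of
    \<open>exact4_kernel_cokernel\<close> for \<open>god_delta X F 0\<close>.\<close>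
  have maps: "cohom0_incl = the_elem"
    "cohom1_proj X F = (\<lambda>x. god_delta X F 0 ` carrier (god_global X F 0) +>\<^bsub>god_global X F 1\<^esub> x)"
    by (simp_all add: fun_eq_iff cohom0_incl_def cohom1_proj_def god_coboundaries_def)
  show "exact4 K (sheaf_cohom X F 0) cohom0_incl (god_global X F 0) (god_delta X F 0)
      (god_global X F 1) (cohom1_proj X F) (sheaf_cohom X F 1)"
    unfolding H0 H1 maps
    by (rule exact4_kernel_cokernel[OF coeff_object_god_global[OF F] coeff_object_god_global[OF F]])
      (use \<delta>[of 0] in simp)
  fix G :: "('v + 'v set \<times> ('t \<Rightarrow> complex) set, 'r, 'b) presheaf" and \<phi>
  assume "sheaf K X G" and \<phi>: "sheaf_morphism K X F G \<phi>"
  then have G: "presheaf K X G" by (simp add: sheaf_def)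
  show "\<forall>n\<in>{0, 1}.
      god_global_map X F G \<phi> n \<in> coeff_hom K (god_global X F n) (god_global X G n) \<and>
      sheaf_cohom_map X F G \<phi> n \<in> coeff_hom K (sheaf_cohom X F n) (sheaf_cohom X G n)"
    using god_global_map_coeff_hom[OF F G \<phi>] sheaf_cohom_map_coeff_hom[OF F G \<phi>] by blast
  show "\<forall>c\<in>carrier (sheaf_cohom X F 0).
      cohom0_incl (sheaf_cohom_map X F G \<phi> 0 c) = god_global_map X F G \<phi> 0 (cohom0_incl c)"
    using cohom0_incl_natural[OF F G \<phi>] by blast
  show "\<forall>x\<in>carrier (god_global X F 0).
      god_delta X G 0 (god_global_map X F G \<phi> 0 x) = god_global_map X F G \<phi> 1 (god_delta X F 0 x)"
    using god_delta_natural[OF F G \<phi>, of _ 0] by simp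
  show "\<forall>x\<in>carrier (god_global X F 1).
      cohom1_proj X G (god_global_map X F G \<phi> 1 x) = sheaf_cohom_map X F G \<phi> 1 (cohom1_proj X F x)"
    using sheaf_cohom_map_rcos[OF F G \<phi>, of _ 1] by (simp add: cohom1_proj_def)
qed

end
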